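(* Let $T\in(2\pi,\infty)\setminus 2\pi\mathbb{N}$, let $\theta$ be the unique odd solution of the pendulum equation $\ddot\theta+\sin\theta=0$ which is periodic with minimal period $T$ and has $\dot\theta(0)>0$, and let $\mathbf{\Theta}=(\Theta_n)_{n\in\mathbb{Z}}$ be the one-site breather $\Theta_0=\theta$, $\Theta_n=0$ for $n\neq 0$, which is a solution of the TDSG system at coupling $\alpha=0$. Then there exists $\epsilon>0$ such that there is a unique continuous family $\mathbf{\Theta}_\alpha\in\Omega^-_{T,2}$, $\alpha\in[0,\epsilon)$, with $\mathbf{\Theta}_0=\mathbf{\Theta}$ and with $\mathbf{\Theta}_\alpha$ an (odd, $T$-periodic) solution of the TDSG system at coupling $\alpha$ for each $\alpha$. Moreover, these solutions are exponentially localized: for each $\alpha\in[0,\epsilon)$ there exist positive constants $B$ and $C$ (depending on $T$ and $\alpha$) such that $|(\mathbf{\Theta}_\alpha)_n|_0\le C\exp(-B|n|)$ for all $n\in\mathbb{Z}$.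
   Context: The topological discrete sine-Gordon (TDSG) system at coupling $\alpha\in\mathbb{R}$ is the system of ODEs, for functions $\psi_n:\mathbb{R}\to\mathbb{R}$, $n\in\mathbb{Z}$, $$\ddot\psi_n=\alpha\cos\psi_n(\sin\psi_{n+1}+\sin\psi_{n-1})-\left(\alpha+\tfrac12\right)\sin\psi_n(\cos\psi_{n+1}+\cos\psi_{n-1}).$$ $C^-_{T,2}$ is the Banach space of $C^2$, $T$-periodic, odd functions $\psi:\mathbb{R}\to\mathbb{R}$ with norm $|\psi|_2=\sup_{t}\max\{|\psi(t)|,|\dot\psi(t)|,|\ddot\psi(t)|\}$. For a bounded function, $|\psi|_0=\sup_t|\psi(t)|$. $\Omega^-_{T,2}$ is the Banach space of all sequences $\mathbf{\Psi}=(\psi_n)_{n\in\mathbb{Z}}$ with each $\psi_n\in C^-_{T,2}$ and $\|\mathbf{\Psi}\|_2=\sup_{n}|\psi_n|_2<\infty$; continuity of a family in $\alpha$ is with respect to $\|\cdot\|_2$. "Odd" means odd in time: $\mathbf{\Psi}(-t)=-\mathbf{\Psi}(t)$. *)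

theory Defs
  imports "HOL-Analysis.Analysis" "HOL-Library.Periodic_Fun"
begin

definition odd_fun :: "(real \<Rightarrow> real) \<Rightarrow> bool" where
  "odd_fun f \<longleftrightarrow> (\<forall>t. f (- t) = - f t)"

definition C2 :: "(real \<Rightarrow> real) \<Rightarrow> bool" where
  "C2 f \<longleftrightarrow> f differentiable_on UNIV \<and> deriv f differentiable_on UNIV \<and>
     continuous_on UNIV (deriv (deriv f))"

definition C2_odd_periodic :: "real \<Rightarrow> (real \<Rightarrow> real) set" where
  "C2_odd_periodic T = {f. C2 f \<and> periodic_fun_simple f T \<and> odd_fun f}"

(* The suprema below are taken in the reals, so they are meaningful only where the
   functions (resp. the sequence of norms) are bounded: this holds on C2_odd_periodic T
   for T > 0, and on Omega T, respectively. *)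
definition sup_norm :: "(real \<Rightarrow> real) \<Rightarrow> real" where
  "sup_norm f = (SUP t. \<bar>f t\<bar>)"

definition C2_norm :: "(real \<Rightarrow> real) \<Rightarrow> real" where
  "C2_norm f = (SUP t. max \<bar>f t\<bar> (max \<bar>deriv f t\<bar> \<bar>deriv (deriv f) t\<bar>))"

definition Omega :: "real \<Rightarrow> (int \<Rightarrow> real \<Rightarrow> real) set" where
  "Omega T = {\<Psi>. (\<forall>n. \<Psi> n \<in> C2_odd_periodic T) \<and> bdd_above (range (\<lambda>n. C2_norm (\<Psi> n)))}"

definition Omega_norm :: "(int \<Rightarrow> real \<Rightarrow> real) \<Rightarrow> real" where
  "Omega_norm \<Psi> = (SUP n. C2_norm (\<Psi> n))"

definition pendulum_solution :: "(real \<Rightarrow> real) \<Rightarrow> bool" where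
  "pendulum_solution \<theta> \<longleftrightarrow>
     (\<forall>t. \<theta> differentiable (at t) \<and> (deriv \<theta> has_real_derivative - sin (\<theta> t)) (at t))"

definition has_minimal_period :: "(real \<Rightarrow> real) \<Rightarrow> real \<Rightarrow> bool" where
  "has_minimal_period f T \<longleftrightarrow>
     T > 0 \<and> periodic_fun_simple f T \<and> (\<forall>S. 0 < S \<and> S < T \<longrightarrow> \<not> periodic_fun_simple f S)"

definition TDSG_solution :: "real \<Rightarrow> (int \<Rightarrow> real \<Rightarrow> real) \<Rightarrow> bool" where
  "TDSG_solution \<alpha> \<Psi> \<longleftrightarrow>
     (\<forall>n t. \<Psi> n differentiable (at t) \<and>
       (deriv (\<Psi> n) has_real_derivative
          \<alpha> * cos (\<Psi> n t) * (sin (\<Psi> (n + 1) t) + sin (\<Psi> (n - 1) t))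
          - (\<alpha> + 1 / 2) * sin (\<Psi> n t) * (cos (\<Psi> (n + 1) t) + cos (\<Psi> (n - 1) t))) (at t))"

definition one_site_breather :: "(real \<Rightarrow> real) \<Rightarrow> int \<Rightarrow> real \<Rightarrow> real" where
  "one_site_breather \<theta> n = (if n = 0 then \<theta> else (\<lambda>t. 0))"

(* A family is encoded as a total function of the coupling; only its values on
   {0..<\<epsilon>} are relevant. *)
definition Omega_continuous_on :: "real set \<Rightarrow> (real \<Rightarrow> int \<Rightarrow> real \<Rightarrow> real) \<Rightarrow> bool" where
  "Omega_continuous_on A F \<longleftrightarrow>
     (\<forall>\<alpha>\<in>A. ((\<lambda>\<beta>. Omega_norm (\<lambda>n t. F \<beta> n t - F \<alpha> n t)) \<longlongrightarrow> 0) (at \<alpha> within A))"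

definition breather_family ::
  "real \<Rightarrow> (real \<Rightarrow> real) \<Rightarrow> real \<Rightarrow> (real \<Rightarrow> int \<Rightarrow> real \<Rightarrow> real) \<Rightarrow> bool" where
  "breather_family T \<theta> \<epsilon> F \<longleftrightarrow>
     (\<forall>\<alpha>\<in>{0..<\<epsilon>}. F \<alpha> \<in> Omega T \<and> TDSG_solution \<alpha> (F \<alpha>)) \<and>
     Omega_continuous_on {0..<\<epsilon>} F \<and>
     F 0 = one_site_breather \<theta>"

end

(* Writing Psi = Theta + phi turns the system into phi_n'' + q_n phi_n = N_n(alpha, phi), where
   q_0 = cos theta, q_1 = q_(-1) = (1 + cos theta)/2, q_n = 1 otherwise, and N has small Lipschitz
   constant for small alpha and phi.  Each operator d^2/dt^2 + q_n is invertible on odd T-periodic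
   functions: for q_n = 1 because T is not a multiple of 2 pi, and otherwise by Sturm comparison
   with theta itself, which solves y'' + (sin theta / theta) y = 0, has no zero in (0, T/2), and
   satisfies q_n theta < sin theta there (x cos x < sin x on (0, pi)).  So the corrections are the
   fixed points of a contraction on a small ball in the sup norm; a continuous family starting at
   Theta cannot leave this ball because solutions in the ball lie in the ball of half the radius.
   Since N_n vanishes at phi = 0 for |n| >= 2, the size of phi_n is at most half the maximum over
   n - 1, n, n + 1, which gives geometric decay. *)

theory Submission
  imports Defs
begin

section \<open>Second-order equations on the line\<close>

text \<open>All potentials satisfy \<open>\<bar>q t\<bar> \<le> 1\<close>. That single bound makes
  one energy estimate suffice for uniqueness and one exponential weight suffice for existence.
  Potentials are symmetric and right-hand sides antisymmetric about both 0 and T/2, so "odd and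
  T-periodic" can be traded for the Dirichlet conditions at 0 and T/2, and inverting d^2/dt^2 + q
  becomes shooting from 0 to T/2. The obstacle is uniformity over infinitely many sites. Only three
  different potentials occur, so one constant \<open>M\<close> bounds all the inverses in the sup
  norm. The contraction uses merely continuous functions. Smoothness and C^2 norms are recovered
  afterwards from the equation, because the first derivative is controlled by the function and its
  second derivative. Self-map, contraction, uniqueness, Lipschitz dependence on the coupling and
  decay all come from one comparison estimate, \<open>local_comparison\<close>, which looks only at
  a site and its two neighbours. Equations are written \<open>has_second_derivative u g\<close> with
  an explicit right-hand side, so that they can be added, subtracted and reflected.\<close>

definition has_second_derivative :: "(real \<Rightarrow> real) \<Rightarrow> (real \<Rightarrow> real) \<Rightarrow> bool" where
  "has_second_derivative u g \<longleftrightarrow>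
     (\<forall>t. (u has_real_derivative deriv u t) (at t) \<and> (deriv u has_real_derivative g t) (at t))"

lemma has_second_derivativeI:
  assumes "\<And>t. (u has_real_derivative v t) (at t)" "\<And>t. (v has_real_derivative g t) (at t)"
  shows "has_second_derivative u g"
proof -
  have "deriv u = v"
    using assms(1) by (auto intro: DERIV_imp_deriv)
  then show ?thesis
    using assms by (simp add: has_second_derivative_def)
qed

lemma has_second_derivativeD:
  assumes "has_second_derivative u g"
  shows "(u has_real_derivative deriv u t) (at t)" "(deriv u has_real_derivative g t) (at t)"
  using assms by (auto simp: has_second_derivative_def)

lemma has_second_derivative_continuous:
  assumes "has_second_derivative u g"
  shows "continuous_on S u" "continuous_on S (deriv u)"
  using has_second_derivativeD[OF assms] by (meson DERIV_continuous continuous_at_imp_continuous_on)+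

lemma has_second_derivative_deriv_deriv:
  "has_second_derivative u g \<Longrightarrow> deriv (deriv u) = g"
  by (rule ext) (rule DERIV_imp_deriv, rule has_second_derivativeD(2))

lemma has_second_derivative_lincomb:
  assumes "has_second_derivative u f" "has_second_derivative v g"
  shows "has_second_derivative (\<lambda>t. a * u t + b * v t) (\<lambda>t. a * f t + b * g t)"
    and "deriv (\<lambda>t. a * u t + b * v t) = (\<lambda>t. a * deriv u t + b * deriv v t)"
proof -
  note D = has_second_derivativeD[OF assms(1)] has_second_derivativeD[OF assms(2)]
  have 1: "((\<lambda>t. a * u t + b * v t) has_real_derivative a * deriv u t + b * deriv v t) (at t)" for t
    by (auto intro!: derivative_eq_intros D)
  have 2: "((\<lambda>t. a * deriv u t + b * deriv v t) has_real_derivative a * f t + b * g t) (at t)" for t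
    by (auto intro!: derivative_eq_intros D)
  from 1 2 show "has_second_derivative (\<lambda>t. a * u t + b * v t) (\<lambda>t. a * f t + b * g t)"
    by (rule has_second_derivativeI)
  from 1 show "deriv (\<lambda>t. a * u t + b * v t) = (\<lambda>t. a * deriv u t + b * deriv v t)"
    by (auto intro: DERIV_imp_deriv)
qed

lemma has_second_derivative_diff:
  assumes "has_second_derivative u f" "has_second_derivative v g"
  shows "has_second_derivative (\<lambda>t. u t - v t) (\<lambda>t. f t - g t)"
    and "deriv (\<lambda>t. u t - v t) = (\<lambda>t. deriv u t - deriv v t)"
  using has_second_derivative_lincomb[OF assms, of 1 "-1"] by simp_all

text \<open>Reflection about \<open>c / 2\<close>. The case \<open>c = 0\<close> is time reversal,
  \<open>c = T\<close> gives the symmetry about T/2, and \<open>c = 2 * s\<close> the symmetry about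
  a zero \<open>s\<close> of \<theta>.\<close>

lemma has_second_derivative_reflect:
  assumes "has_second_derivative u f"
  shows "has_second_derivative (\<lambda>t. u (c - t)) (\<lambda>t. f (c - t))"
    and "deriv (\<lambda>t. u (c - t)) = (\<lambda>t. - deriv u (c - t))"
proof -
  note D = has_second_derivativeD[OF assms]
  have *: "((\<lambda>s. c - s) has_real_derivative -1) (at t)" for t
    by (auto intro!: derivative_eq_intros)
  have 1: "((\<lambda>t. u (c - t)) has_real_derivative - deriv u (c - t)) (at t)" for t
    using DERIV_chain2[OF D(1) *] by simp
  have 2: "((\<lambda>t. - deriv u (c - t)) has_real_derivative f (c - t)) (at t)" for t
    using DERIV_minus[OF DERIV_chain2[OF D(2) *]] by simp
  from 1 2 show "has_second_derivative (\<lambda>t. u (c - t)) (\<lambda>t. f (c - t))"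
    by (rule has_second_derivativeI)
  from 1 show "deriv (\<lambda>t. u (c - t)) = (\<lambda>t. - deriv u (c - t))"
    by (auto intro: DERIV_imp_deriv)
qed

lemma has_second_derivative_zero: "has_second_derivative (\<lambda>t. 0) (\<lambda>t. 0)"
  by (rule has_second_derivativeI[where v = "\<lambda>t. 0"]) auto

text \<open>The energy \<open>w\<^sup>2 + w'\<^sup>2\<close> grows at most like \<open>e\<^bsup>2t\<^esup>\<close>.\<close>

lemma second_order_zero_forward:
  assumes w: "has_second_derivative w g" and g: "\<And>t. \<bar>g t\<bar> \<le> \<bar>w t\<bar>"
    and 0: "w t0 = 0" "deriv w t0 = 0" and t: "t0 \<le> t"
  shows "w t = 0"
proof -
  define E where "E = (\<lambda>t. ((w t)\<^sup>2 + (deriv w t)\<^sup>2) * exp (- 2 * t))"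
  note D = has_second_derivativeD[OF w]
  have dE: "(E has_real_derivative (2 * w s * deriv w s + 2 * deriv w s * g s
      - 2 * ((w s)\<^sup>2 + (deriv w s)\<^sup>2)) * exp (- 2 * s)) (at s)" for s
    unfolding E_def by (auto intro!: derivative_eq_intros D simp: algebra_simps)
  have neg: "2 * w s * deriv w s + 2 * deriv w s * g s - 2 * ((w s)\<^sup>2 + (deriv w s)\<^sup>2) \<le> 0" for s
  proof -
    have "(g s)\<^sup>2 \<le> (w s)\<^sup>2"
      using g[of s] by (simp add: abs_le_square_iff)
    then show ?thesis
      \<comment> \<open>The two cross terms are at most w^2 + w'^2 and w'^2 + g^2, and g^2 is at
        most w^2; the total is exactly what the weight subtracts.\<close>
      using sum_squares_bound[of "w s" "deriv w s"] sum_squares_bound[of "deriv w s" "g s"]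
      unfolding distrib_left by linarith
  qed
  have "E t \<le> E t0"
    by (rule DERIV_nonpos_imp_nonincreasing[OF t])
       (use dE neg in \<open>blast intro: mult_nonpos_nonneg exp_ge_zero\<close>)
  then have "((w t)\<^sup>2 + (deriv w t)\<^sup>2) * exp (- 2 * t) \<le> 0"
    using 0 by (simp add: E_def)
  then have "(w t)\<^sup>2 + (deriv w t)\<^sup>2 \<le> 0"
    by (simp add: mult_le_0_iff)
  then show ?thesis
    by (simp add: sum_power2_le_zero_iff)
qed

text \<open>Earlier times follow by time reversal. This is the only uniqueness principle for initial
  values in the development: it serves linear equations with \<open>\<bar>q t\<bar> \<le> 1\<close>
  and, since sin is 1-Lipschitz, also sums and differences of pendulum solutions.\<close>

lemma second_order_zero:
  assumes w: "has_second_derivative w g" and g: "\<And>t. \<bar>g t\<bar> \<le> \<bar>w t\<bar>"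
    and 0: "w t0 = 0" "deriv w t0 = 0"
  shows "w t = 0"
proof (cases "t0 \<le> t")
  case True
  then show ?thesis using second_order_zero_forward[OF w g 0] by blast
next
  case False
  show ?thesis
    using second_order_zero_forward[OF has_second_derivative_reflect(1)[OF w, of 0],
        where ?t0.0 = "- t0" and t = "- t"] False 0 g
    by (simp add: has_second_derivative_reflect(2)[OF w, of 0, simplified])
qed

lemma antiderivative_exists:
  fixes g :: "real \<Rightarrow> real"
  assumes "continuous_on UNIV g"
  shows "\<exists>P. P 0 = 0 \<and> (\<forall>t. (P has_real_derivative g t) (at t))"
proof (intro exI[where x = "\<lambda>u. LBINT y=ereal 0..ereal u. g y"] conjI allI)
  fix t :: real
  let ?a = "- \<bar>t\<bar> - 1" and ?b = "\<bar>t\<bar> + 1"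
  have "((\<lambda>u. LBINT y=ereal 0..ereal u. g y) has_vector_derivative g t) (at t within {?a..?b})"
    by (rule interval_integral_FTC2) (use assms continuous_on_subset in auto)
  moreover have "at t within {?a..?b} = at t"
    by (rule at_within_Icc_at) auto
  ultimately show "((\<lambda>u. LBINT y=ereal 0..ereal u. g y) has_real_derivative g t) (at t)"
    by (simp add: has_real_derivative_iff_has_vector_derivative)
qed (simp add: zero_ereal_def[symmetric])

text \<open>The comparison function \<open>c / 2 * exp (2 * t)\<close> has the assumed bound as its
  derivative, so each integration gains a factor 1/2 in the weighted norm; two integrations give the
  1/4 used below.\<close>

lemma weighted_antiderivative_bound_forward:
  assumes P: "\<And>t. (P has_real_derivative g t) (at t)" "P 0 = 0"
    and g: "\<And>t. \<bar>g t\<bar> \<le> c * exp (2 * \<bar>t\<bar>)" and t: "t \<ge> 0"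
  shows "\<bar>P t\<bar> \<le> c / 2 * exp (2 * \<bar>t\<bar>)"
proof -
  have c: "c \<ge> 0" using g[of 0] by simp
  have "P t - c / 2 * exp (2 * t) \<le> P 0 - c / 2 * exp (2 * 0)"
  proof (rule DERIV_nonpos_imp_nonincreasing[OF t])
    fix s :: real assume "0 \<le> s" "s \<le> t"
    have "((\<lambda>t. P t - c / 2 * exp (2 * t)) has_real_derivative g s - c * exp (2 * s)) (at s)"
      by (auto intro!: derivative_eq_intros P)
    then show "\<exists>y. ((\<lambda>t. P t - c / 2 * exp (2 * t)) has_real_derivative y) (at s) \<and> y \<le> 0"
      using g[of s] \<open>0 \<le> s\<close> by (intro exI conjI) auto
  qed
  moreover have "P t + c / 2 * exp (2 * t) \<ge> P 0 + c / 2 * exp (2 * 0)"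
  proof (rule DERIV_nonneg_imp_nondecreasing[OF t])
    fix s :: real assume "0 \<le> s" "s \<le> t"
    have "((\<lambda>t. P t + c / 2 * exp (2 * t)) has_real_derivative g s + c * exp (2 * s)) (at s)"
      by (auto intro!: derivative_eq_intros P)
    moreover have "0 \<le> g s + c * exp (2 * s)"
      using g[of s] \<open>0 \<le> s\<close> by auto
    ultimately show "\<exists>y. ((\<lambda>t. P t + c / 2 * exp (2 * t)) has_real_derivative y) (at s) \<and> 0 \<le> y"
      by blast
  qed
  ultimately show ?thesis
    using P(2) c t by auto
qed

lemma weighted_antiderivative_bound:
  assumes P: "\<And>t. (P has_real_derivative g t) (at t)" "P 0 = 0"
    and g: "\<And>t. \<bar>g t\<bar> \<le> c * exp (2 * \<bar>t\<bar>)"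
  shows "\<bar>P t\<bar> \<le> c / 2 * exp (2 * \<bar>t\<bar>)"
proof (cases "t \<ge> 0")
  case True
  then show ?thesis by (rule weighted_antiderivative_bound_forward[OF P g])
next
  case False
  have "\<bar>(\<lambda>t. - P (- t)) (- t)\<bar> \<le> c / 2 * exp (2 * \<bar>- t\<bar>)"
  proof (rule weighted_antiderivative_bound_forward)
    show "((\<lambda>t. - P (- t)) has_real_derivative g (- s)) (at s)" for s
      using DERIV_minus[OF DERIV_chain2[OF P(1) DERIV_minus[OF DERIV_ident]]] by simp
    show "\<bar>g (- s)\<bar> \<le> c * exp (2 * \<bar>s\<bar>)" for s
      using g[of "- s"] by simp
  qed (use P False in auto)
  then show ?thesis by simp
qed

lemma weighted_double_antiderivative_bound:
  assumes u: "has_second_derivative u g" "u 0 = 0" "deriv u 0 = 0"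
    and g: "\<And>t. \<bar>g t\<bar> \<le> c * exp (2 * \<bar>t\<bar>)"
  shows "\<bar>u t\<bar> \<le> c / 4 * exp (2 * \<bar>t\<bar>)"
proof -
  note D = has_second_derivativeD[OF u(1)]
  show ?thesis
    using weighted_antiderivative_bound[OF D(1) u(2), of "c / 2"]
      weighted_antiderivative_bound[OF D(2) u(3) g] by simp
qed

lemma double_antiderivative_exists:
  assumes "continuous_on UNIV g"
  shows "\<exists>u. has_second_derivative u g \<and> u 0 = 0 \<and> deriv u 0 = 0"
proof -
  obtain P where P: "P 0 = 0" "\<And>t. (P has_real_derivative g t) (at t)"
    using antiderivative_exists[OF assms] by blast
  have "continuous_on UNIV P"
    using P(2) by (meson DERIV_continuous continuous_at_imp_continuous_on)
  then obtain u where u: "u 0 = 0" "\<And>t. (u has_real_derivative P t) (at t)"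
    using antiderivative_exists by blast
  have "deriv u 0 = 0"
    using DERIV_imp_deriv[OF u(2)] P(1) by simp
  then show ?thesis
    using u P has_second_derivativeI by blast
qed

text \<open>Solving the Volterra equation \<open>u = u\<^sub>0 - \<integral>\<integral> q u\<close> is a contraction
  with factor \<open>1/4\<close> in the norm weighted by \<open>e\<^bsup>-2\<bar>t\<bar>\<^esup>\<close>.\<close>

lemma linear_ivp_exists:
  assumes q: "continuous_on UNIV q" "\<And>t. \<bar>q t\<bar> \<le> 1"
    and u0: "has_second_derivative u0 f" "\<And>t. \<bar>u0 t\<bar> \<le> c * exp (2 * \<bar>t\<bar>)"
  shows "\<exists>u. has_second_derivative u (\<lambda>t. f t - q t * u t) \<and> u 0 = u0 0 \<and> deriv u 0 = deriv u0 0
           \<and> (\<forall>t. \<bar>u t\<bar> \<le> 4 / 3 * c * exp (2 * \<bar>t\<bar>))"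
proof -
  define A where "A = (\<lambda>g. SOME u. has_second_derivative u g \<and> u 0 = 0 \<and> deriv u 0 = 0)"
  have A: "has_second_derivative (A g) g" "A g 0 = 0" "deriv (A g) 0 = 0"
    if "continuous_on UNIV g" for g
    using someI_ex[OF double_antiderivative_exists[OF that]] unfolding A_def by auto
  \<comment> \<open>The unknown \<open>u\<close> is stored as the bounded function v = exp(-2|t|) u,
    so that the sup distance on bounded continuous functions is the weighted distance of the
    \<open>u\<close>. Thus \<open>k v\<close> is the double antiderivative of \<open>q\<close> times
    \<open>u\<close>.\<close>
  define k :: "(real \<Rightarrow>\<^sub>C real) \<Rightarrow> real \<Rightarrow> real" where
    "k v = A (\<lambda>t. q t * exp (2 * \<bar>t\<bar>) * v t)" for v
  have cont: "continuous_on UNIV (\<lambda>t. q t * exp (2 * \<bar>t\<bar>) * apply_bcontfun v t)" for v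
    by (intro continuous_intros q) auto
  note k = A[OF cont, folded k_def]
  have k_diff: "\<bar>k v t - k w t\<bar> \<le> dist v w / 4 * exp (2 * \<bar>t\<bar>)" for v w t
  proof (rule weighted_double_antiderivative_bound
      [where u = "\<lambda>t. k v t - k w t", OF has_second_derivative_diff(1)[OF k(1) k(1)]])
    fix s
    have "\<bar>q s * exp (2 * \<bar>s\<bar>) * v s - q s * exp (2 * \<bar>s\<bar>) * w s\<bar>
        = \<bar>q s\<bar> * (exp (2 * \<bar>s\<bar>) * dist (v s) (w s))"
      by (simp add: abs_mult dist_real_def flip: right_diff_distrib)
    also have "\<dots> \<le> 1 * (exp (2 * \<bar>s\<bar>) * dist v w)"
      by (intro mult_mono q dist_bounded) auto
    finally show "\<bar>q s * exp (2 * \<bar>s\<bar>) * v s - q s * exp (2 * \<bar>s\<bar>) * w s\<bar>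
        \<le> dist v w * exp (2 * \<bar>s\<bar>)" by (simp add: mult.commute)
  qed (simp_all add: k has_second_derivative_diff(2)[OF k(1) k(1)])
  have k_bound: "\<bar>k v t\<bar> \<le> norm v / 4 * exp (2 * \<bar>t\<bar>)" for v t
  proof (rule weighted_double_antiderivative_bound[OF k(1)])
    fix s
    have "\<bar>q s * exp (2 * \<bar>s\<bar>) * v s\<bar> = \<bar>q s\<bar> * (exp (2 * \<bar>s\<bar>) * norm (v s))"
      by (simp add: abs_mult)
    also have "\<dots> \<le> 1 * (exp (2 * \<bar>s\<bar>) * norm v)"
      by (intro mult_mono q norm_bounded) auto
    finally show "\<bar>q s * exp (2 * \<bar>s\<bar>) * v s\<bar> \<le> norm v * exp (2 * \<bar>s\<bar>)"
      by (simp add: mult.commute)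
  qed (simp_all add: k)
  define h where "h = (\<lambda>v t. exp (- 2 * \<bar>t\<bar>) * (u0 t - k v t))"
  have h_le: "\<bar>h v t\<bar> \<le> c + norm v / 4" for v t
  proof -
    have "\<bar>h v t\<bar> \<le> exp (- 2 * \<bar>t\<bar>) * ((c + norm v / 4) * exp (2 * \<bar>t\<bar>))"
      unfolding h_def abs_mult using u0(2)[of t] k_bound[of v t]
      by (intro mult_mono) (auto simp: algebra_simps)
    also have "\<dots> = c + norm v / 4" by (simp add: exp_minus)
    finally show ?thesis .
  qed
  define H where "H = (\<lambda>v. Bcontfun (h v))"
  have "h v \<in> bcontfun" for v
  proof (rule bcontfun_normI)
    show "continuous_on UNIV (h v)"
      unfolding h_def using has_second_derivative_continuous(1)[OF u0(1)]
        has_second_derivative_continuous(1)[OF k(1)[of v]]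
      by (intro continuous_intros) auto
    show "norm (h v t) \<le> c + norm v / 4" for t
      using h_le[of v t] by simp
  qed
  then have H: "apply_bcontfun (H v) = h v" for v
    by (simp add: H_def Bcontfun_inverse)
  have "\<exists>!v. H v = v"
  proof (rule banach_fix_type[where c = "1/4"])
    show "\<forall>v w. dist (H v) (H w) \<le> 1/4 * dist v w"
    proof (intro allI dist_bound)
      fix v w t
      have "dist (H v t) (H w t) = exp (- 2 * \<bar>t\<bar>) * \<bar>k w t - k v t\<bar>"
        by (simp add: H h_def dist_real_def abs_mult flip: right_diff_distrib)
      also have "\<dots> \<le> exp (- 2 * \<bar>t\<bar>) * (dist w v / 4 * exp (2 * \<bar>t\<bar>))"
        by (intro mult_left_mono k_diff) auto
      finally show "dist (H v t) (H w t) \<le> 1/4 * dist v w"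
        by (simp add: exp_minus field_simps dist_commute)
    qed
  qed auto
  then obtain v where v: "H v = v" by blast
  define u where "u = (\<lambda>t. exp (2 * \<bar>t\<bar>) * v t)"
  have u_eq: "u = (\<lambda>t. u0 t - k v t)"
  proof
    fix t
    have "v t = exp (- 2 * \<bar>t\<bar>) * (u0 t - k v t)"
      using H[of v] v by (simp add: h_def fun_eq_iff)
    then show "u t = u0 t - k v t"
      by (simp add: u_def exp_minus)
  qed
  \<comment> \<open>At the fixed point the bound \<open>h_le\<close> refers back to
    \<open>norm v\<close>; absorbing the quarter produces the factor 4/3 in the conclusion.\<close>
  have "norm v \<le> c + norm v / 4"
    using h_le[of v] H[of v] v by (intro norm_bound) simp
  then have nv: "norm v \<le> 4 / 3 * c" by simp
  have "\<bar>u t\<bar> \<le> 4 / 3 * c * exp (2 * \<bar>t\<bar>)" for t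
  proof -
    have "\<bar>v t\<bar> \<le> 4 / 3 * c"
      using norm_bounded[of v t] nv by simp
    then show ?thesis by (simp add: u_def abs_mult mult.commute mult_right_mono)
  qed
  moreover have "has_second_derivative u (\<lambda>t. f t - q t * u t)"
    using has_second_derivative_diff(1)[OF u0(1) k(1)[of v]]
    by (subst u_eq) (simp add: u_def mult.assoc)
  moreover have "u 0 = u0 0" "deriv u 0 = deriv u0 0"
    using k[of v] by (simp_all add: u_eq has_second_derivative_diff(2)[OF u0(1) k(1)])
  ultimately show ?thesis by blast
qed

section \<open>Odd periodic solutions\<close>

text \<open>Only continuity is demanded: this is the sup-norm setting of the fixed-point argument,
  where differentiability is supplied by the equation.\<close>

definition odd_periodic :: "real \<Rightarrow> (real \<Rightarrow> real) \<Rightarrow> bool" where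
  "odd_periodic T f \<longleftrightarrow> continuous_on UNIV f \<and> (\<forall>t. f (t + T) = f t) \<and> (\<forall>t. f (- t) = - f t)"

lemma periodic_reduce:
  fixes f :: "real \<Rightarrow> real"
  assumes "T > 0" "\<And>t. f (t + T) = f t"
  shows "\<exists>s\<in>{0..T}. f t = f s"
proof
  interpret periodic_fun_simple f T
    by standard (rule assms)
  let ?s = "t - of_int \<lfloor>t / T\<rfloor> * T"
  show "f t = f ?s"
    by (simp add: minus_of_int)
  have "of_int \<lfloor>t / T\<rfloor> * T \<le> t" "t < (of_int \<lfloor>t / T\<rfloor> + 1) * T"
    using assms(1) by (auto simp flip: pos_le_divide_eq pos_divide_less_eq)
  then show "?s \<in> {0..T}"
    by (auto simp: algebra_simps)
qed

lemma periodic_bounded: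
  fixes f :: "real \<Rightarrow> real"
  assumes "T > 0" "continuous_on UNIV f" "\<And>t. f (t + T) = f t"
  shows "\<exists>c\<ge>0. \<forall>t. \<bar>f t\<bar> \<le> c"
proof -
  have "compact (f ` {0..T})"
    using assms(2) by (intro compact_continuous_image) (auto intro: continuous_on_subset)
  then obtain c where c: "\<And>x. x \<in> f ` {0..T} \<Longrightarrow> norm x \<le> c"
    using compact_imp_bounded bounded_iff by metis
  have *: "\<bar>f t\<bar> \<le> c" for t
    using periodic_reduce[of T f t] assms c by auto
  then show ?thesis
    using order_trans[OF abs_ge_zero *] by blast
qed

lemma odd_periodic_half:
  assumes "odd_periodic T f"
  shows "f (T / 2) = 0"
proof -
  have "f (- (T / 2) + T) = f (- (T / 2))" "f (- (T / 2)) = - f (T / 2)"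
    using assms unfolding odd_periodic_def by blast+
  then show ?thesis by simp
qed

lemma odd_periodic_0: "odd_periodic T f \<Longrightarrow> f 0 = 0"
  unfolding odd_periodic_def by (metis minus_zero neg_equal_zero)

definition nondegenerate :: "real \<Rightarrow> (real \<Rightarrow> real) \<Rightarrow> bool" where
  "nondegenerate T q \<longleftrightarrow>
     (\<forall>y. has_second_derivative y (\<lambda>t. - q t * y t) \<longrightarrow> odd_periodic T y \<longrightarrow> (\<forall>t. y t = 0))"

text \<open>For \<open>c = 0\<close> and \<open>c = T\<close> the function w(t) + w(c - t) solves
  the homogeneous equation. At \<open>c / 2\<close> its value vanishes by the Dirichlet condition
  and its derivative by symmetry, so it is zero. Antisymmetry about 0 and about T/2 together give
  oddness and period T.\<close>

lemma dirichlet_imp_odd_periodic: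
  assumes q: "\<And>t. \<bar>q t\<bar> \<le> 1" "\<And>t. q (- t) = q t" "\<And>t. q (t + T) = q t"
    and f: "\<And>t. f (- t) = - f t" "\<And>t. f (t + T) = f t"
    and w: "has_second_derivative w (\<lambda>t. f t - q t * w t)" "w 0 = 0" "w (T / 2) = 0"
  shows "odd_periodic T w"
proof -
  have antisym: "w (c - t) = - w t"
    if c: "\<And>t. q (c - t) = q t" "\<And>t. f (c - t) = - f t" "w (c / 2) = 0" for c t
  proof -
    note R = has_second_derivative_reflect[OF w(1), of c]
    note L = has_second_derivative_lincomb[OF w(1) R(1), of 1 1]
    have "1 * w t + 1 * w (c - t) = 0"
    proof (rule second_order_zero[OF L(1)])
      fix s
      have "1 * (f s - q s * w s) + 1 * (f (c - s) - q (c - s) * w (c - s)) = - q s * (w s + w (c - s))"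
        using c by (simp add: algebra_simps)
      then show "\<bar>1 * (f s - q s * w s) + 1 * (f (c - s) - q (c - s) * w (c - s))\<bar>
          \<le> \<bar>1 * w s + 1 * w (c - s)\<bar>"
        using mult_right_mono[OF q(1)[of s] abs_ge_zero[of "w s + w (c - s)"]] by (simp add: abs_mult)
    next
      show "1 * w (c / 2) + 1 * w (c - c / 2) = 0" using c by simp
      show "deriv (\<lambda>t. 1 * w t + 1 * w (c - t)) (c / 2) = 0"
        unfolding L(2) R(2) by simp
    qed
    then show ?thesis by simp
  qed
  have odd: "w (- t) = - w t" for t
    using antisym[of 0 t] q f w by simp
  have "w (t + T) = w t" for t
  proof -
    have "q (T - t) = q t" "f (T - t) = - f t" for t
      using q(2,3)[of "- t"] q(2)[of t] f(2)[of "- t"] f(1)[of t] by (simp_all add: add.commute)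
    then have "w (T - (- t)) = - w (- t)"
      using w by (intro antisym) auto
    then show ?thesis using odd by (simp add: add.commute)
  qed
  then show ?thesis
    using odd has_second_derivative_continuous[OF w(1)] by (simp add: odd_periodic_def)
qed

text \<open>A Fredholm alternative by shooting: the solution \<open>y\<close> with
  \<open>y 0 = 0\<close> and slope 1 does not vanish at T/2, so a multiple of it corrects any
  particular solution to satisfy the Dirichlet conditions. The bound is stated for every odd
  periodic solution, not just the constructed one, so it applies to differences and contains
  uniqueness.\<close>

lemma nondegenerate_solvable:
  assumes T: "T > 0"
    and q: "continuous_on UNIV q" "\<And>t. \<bar>q t\<bar> \<le> 1" "\<And>t. q (- t) = q t" "\<And>t. q (t + T) = q t"
    and nd: "nondegenerate T q"
  shows "\<exists>M>0. (\<forall>f. odd_periodic T f \<longrightarrow>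
             (\<exists>w. odd_periodic T w \<and> has_second_derivative w (\<lambda>t. f t - q t * w t))) \<and>
           (\<forall>w f c t. odd_periodic T w \<longrightarrow> has_second_derivative w (\<lambda>t. f t - q t * w t) \<longrightarrow>
             continuous_on UNIV f \<longrightarrow> (\<forall>t. \<bar>f t\<bar> \<le> c) \<longrightarrow> \<bar>w t\<bar> \<le> M * c)"
proof -
  have id: "has_second_derivative (\<lambda>t. t) (\<lambda>t. 0)"
    by (rule has_second_derivativeI[where v = "\<lambda>t. 1"]) (auto intro!: derivative_eq_intros)
  have "\<bar>t\<bar> \<le> 1 * exp (2 * \<bar>t\<bar>)" for t :: real
    using exp_ge_add_one_self[of "2 * \<bar>t\<bar>"] abs_ge_zero[of t] by linarith
  from linear_ivp_exists[OF q(1,2) id this] obtain y where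
    y: "has_second_derivative y (\<lambda>t. 0 - q t * y t)" "y 0 = 0" "deriv y 0 = 1"
      "\<And>t. \<bar>y t\<bar> \<le> 4 / 3 * exp (2 * \<bar>t\<bar>)"
    using DERIV_imp_deriv[OF has_second_derivativeD(1)[OF id]] by auto
  define h where "h = T / 2"
  have yh: "y h \<noteq> 0"
  proof
    assume "y h = 0"
    then have "odd_periodic T y"
      by (intro dirichlet_imp_odd_periodic[where f = "\<lambda>t. 0" and q = q] q y) (auto simp: h_def)
    then have "\<forall>t. y t = 0"
      using nd y(1) by (auto simp: nondegenerate_def)
    then have "y = (\<lambda>t. 0)" by auto
    then show False using y(3) by simp
  qed
  have particular: "\<exists>p. has_second_derivative p (\<lambda>t. f t - q t * p t) \<and> p 0 = 0 \<and> deriv p 0 = 0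
      \<and> (\<forall>t. \<bar>p t\<bar> \<le> c / 3 * exp (2 * \<bar>t\<bar>))"
    if f: "continuous_on UNIV f" "\<And>t. \<bar>f t\<bar> \<le> c" for f c
  proof -
    obtain u0 where u0: "has_second_derivative u0 f" "u0 0 = 0" "deriv u0 0 = 0"
      using double_antiderivative_exists[OF f(1)] by blast
    have "\<bar>f t\<bar> \<le> c * exp (2 * \<bar>t\<bar>)" for t
    proof -
      have "c * 1 \<le> c * exp (2 * \<bar>t\<bar>)"
        using f(2)[of 0] by (intro mult_left_mono) auto
      then show ?thesis using f(2)[of t] by linarith
    qed
    then have "\<bar>u0 t\<bar> \<le> c / 4 * exp (2 * \<bar>t\<bar>)" for t
      by (rule weighted_double_antiderivative_bound[OF u0])
    from linear_ivp_exists[OF q(1,2) u0(1) this] u0(2,3) show ?thesis by auto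
  qed
  \<comment> \<open>Any solution is w = p + b y with b = - p(T/2) / y(T/2). On [0, T] the bounds are
    (c/3) exp(2T) for \<open>p\<close>, with c/3 = (4/3)(c/4), and (4/3) exp(2T) for
    \<open>y\<close>; adding them with the bound for \<open>b\<close> gives
    \<open>M * c\<close>.\<close>
  define M where "M = 1 / 3 * exp (2 * T) * (1 + 4 / 3 * exp (2 * T) / \<bar>y h\<bar>)"
  have "M > 0" unfolding M_def by (intro mult_pos_pos add_pos_nonneg) auto
  moreover have "\<exists>w. odd_periodic T w \<and> has_second_derivative w (\<lambda>t. f t - q t * w t)"
    if f: "odd_periodic T f" for f
  proof -
    obtain c where c: "\<And>t. \<bar>f t\<bar> \<le> c"
      using periodic_bounded[OF T] f unfolding odd_periodic_def by metis
    obtain p where p: "has_second_derivative p (\<lambda>t. f t - q t * p t)" "p 0 = 0"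
      using particular[of f c] c f unfolding odd_periodic_def by blast
    define w where "w = (\<lambda>t. 1 * p t + (- p h / y h) * y t)"
    have w: "has_second_derivative w (\<lambda>t. f t - q t * w t)"
      using has_second_derivative_lincomb(1)[OF p(1) y(1), of 1 "- p h / y h", folded w_def]
      by (simp add: w_def algebra_simps)
    have "odd_periodic T w"
      by (rule dirichlet_imp_odd_periodic[OF q(2,3,4) _ _ w])
         (use f p y yh in \<open>auto simp: odd_periodic_def w_def h_def\<close>)
    with w show ?thesis by blast
  qed
  moreover have "\<bar>w t\<bar> \<le> M * c"
    if w: "odd_periodic T w" "has_second_derivative w (\<lambda>t. f t - q t * w t)"
      and f: "continuous_on UNIV f" "\<forall>t. \<bar>f t\<bar> \<le> c" for w f c t
  proof -
    have c: "c \<ge> 0" using f(2) order_trans[OF abs_ge_zero] by blast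
    obtain p where p: "has_second_derivative p (\<lambda>t. f t - q t * p t)" "p 0 = 0" "deriv p 0 = 0"
      "\<And>t. \<bar>p t\<bar> \<le> c / 3 * exp (2 * \<bar>t\<bar>)"
      using particular[OF f(1)] f(2) by blast
    define b where "b = deriv w 0"
    have decomp: "w s = p s + b * y s" for s
    proof -
      note L1 = has_second_derivative_lincomb[OF p(1) y(1), of 1 b, simplified]
      note L = has_second_derivative_diff[OF w(2) L1(1)]
      have "w s - (p s + b * y s) = 0"
      proof (rule second_order_zero[OF L(1), of 0])
        fix s
        have "f s - q s * w s - (f s - q s * p s - b * (q s * y s))
            = - q s * (w s - (p s + b * y s))"
          by (simp add: algebra_simps)
        then show "\<bar>f s - q s * w s - (f s - q s * p s - b * (q s * y s))\<bar>
            \<le> \<bar>w s - (p s + b * y s)\<bar>"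
          using mult_right_mono[OF q(2)[of s] abs_ge_zero[of "w s - (p s + b * y s)"]]
          by (simp add: abs_mult)
      next
        show "deriv (\<lambda>t. w t - (p t + b * y t)) 0 = 0"
          unfolding L(2) L1(2) using p y by (simp add: b_def)
      qed (simp add: p y odd_periodic_0[OF w(1)])
      then show ?thesis by simp
    qed
    have le: "exp (2 * \<bar>s\<bar>) \<le> exp (2 * T)" if "s \<in> {0..T}" for s
      using that by simp
    have p_le: "\<bar>p s\<bar> \<le> c / 3 * exp (2 * T)" if "s \<in> {0..T}" for s
      using p(4)[of s] mult_left_mono[OF le[OF that], of "c / 3"] c by linarith
    have y_le: "\<bar>y s\<bar> \<le> 4 / 3 * exp (2 * T)" if "s \<in> {0..T}" for s
      using y(4)[of s] le[OF that] by linarith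
    have "b = - p h / y h"
      using decomp[of h] odd_periodic_half[OF w(1)] yh by (simp add: h_def field_simps)
    then have "\<bar>b\<bar> = \<bar>p h\<bar> / \<bar>y h\<bar>"
      by simp
    also have "\<dots> \<le> c / 3 * exp (2 * T) / \<bar>y h\<bar>"
      using T by (intro divide_right_mono p_le) (auto simp: h_def)
    finally have b_le: "\<bar>b\<bar> \<le> c / 3 * exp (2 * T) / \<bar>y h\<bar>" .
    obtain s where s: "s \<in> {0..T}" "w t = w s"
      using periodic_reduce[OF T, of w t] w(1) by (auto simp: odd_periodic_def)
    have "\<bar>w s\<bar> \<le> \<bar>p s\<bar> + \<bar>b\<bar> * \<bar>y s\<bar>"
      unfolding decomp[of s] by (metis abs_mult abs_triangle_ineq)
    also have "\<dots> \<le> c / 3 * exp (2 * T) + (c / 3 * exp (2 * T) / \<bar>y h\<bar>) * (4 / 3 * exp (2 * T))"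
      using c by (intro add_mono mult_mono p_le y_le b_le s) auto
    also have "\<dots> = M * c"
      by (simp add: M_def field_simps)
    finally show ?thesis using s by simp
  qed
  ultimately show ?thesis by blast
qed

section \<open>Trigonometric inequalities and the constant potential\<close>

lemma abs_sin_diff_le: "\<bar>sin x - sin y\<bar> \<le> \<bar>x - y :: real\<bar>"
proof -
  have "\<bar>sin x - sin y\<bar> = 2 * (\<bar>sin ((x - y) / 2)\<bar> * \<bar>cos ((x + y) / 2)\<bar>)"
    by (simp add: sin_diff_sin abs_mult)
  also have "\<dots> \<le> 2 * (\<bar>(x - y) / 2\<bar> * 1)"
    by (intro mult_left_mono mult_mono abs_sin_x_le_abs_x) auto
  finally show ?thesis by simp
qed

lemma IVT_zero:
  fixes y :: "real \<Rightarrow> real"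
  assumes "continuous_on UNIV y" "a \<le> b" "y a > 0" "y b \<le> 0"
  shows "\<exists>x. a \<le> x \<and> x \<le> b \<and> y x = 0"
  using IVT2'[of y b 0 a] assms by (auto intro: continuous_on_subset)

lemma pos_after_zero:
  fixes y :: "real \<Rightarrow> real"
  assumes "(y has_real_derivative d) (at 0)" "d > 0" "y 0 = 0" "s > 0"
  shows "\<exists>r>0. r < s \<and> (\<forall>t. 0 < t \<longrightarrow> t \<le> r \<longrightarrow> y t > 0)"
proof -
  obtain e where e: "e > 0" "\<And>h. h > 0 \<Longrightarrow> h < e \<Longrightarrow> y 0 < y (0 + h)"
    using DERIV_pos_inc_right[OF assms(1,2)] by blast
  show ?thesis
    using e assms by (intro exI[of _ "min e s / 2"]) auto
qed

lemma abs_cos_half_le: "\<bar>(1 + cos x) / 2\<bar> \<le> (1 :: real)"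
proof -
  have "\<bar>(1 + c) / 2\<bar> \<le> 1" if "- 1 \<le> c" "c \<le> 1" for c :: real
    using that by (simp add: abs_le_iff)
  then show ?thesis using cos_ge_minus_one cos_le_one by blast
qed

text \<open>The derivative of sin x - x cos x is x sin x, which is positive on the interval.\<close>

lemma mult_cos_less_sin:
  fixes x :: real
  assumes "0 < x" "x < pi"
  shows "x * cos x < sin x"
proof -
  have "(\<lambda>x. sin x - x * cos x) 0 < (\<lambda>x. sin x - x * cos x) x"
  proof (rule DERIV_pos_imp_increasing_open[OF assms(1)])
    fix z assume z: "0 < z" "z < x"
    have "((\<lambda>x. sin x - x * cos x) has_real_derivative z * sin z) (at z)"
      by (auto intro!: derivative_eq_intros)
    moreover have "z * sin z > 0"
      using z assms sin_gt_zero[of z] by simp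
    ultimately show "\<exists>y. ((\<lambda>x. sin x - x * cos x) has_real_derivative y) (at z) \<and> 0 < y"
      by blast
  qed (intro continuous_intros)
  then show ?thesis by simp
qed

text \<open>Since (1 + cos x)/2 = cos(x/2)^2 and sin x = 2 sin(x/2) cos(x/2), this is the preceding
  inequality at x/2 multiplied by 2 cos(x/2).\<close>

lemma mult_cos_half_squared_less_sin:
  fixes x :: real
  assumes "0 < x" "x < pi"
  shows "(1 + cos x) / 2 * x < sin x"
proof -
  have c: "cos (x / 2) > 0" using assms by (intro cos_gt_zero) auto
  have "cos (x / 2) * (x / 2 * cos (x / 2)) < cos (x / 2) * sin (x / 2)"
    using assms by (intro mult_strict_left_mono[OF _ c] mult_cos_less_sin) auto
  then show ?thesis
    using cos_double_cos[of "x / 2"] sin_double[of "x / 2"]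
    by (simp add: power2_eq_square algebra_simps)
qed

text \<open>By uniqueness \<open>y\<close> is \<open>deriv y 0\<close> times sin. It must vanish at
  T/2, where sin does not, because T is not a multiple of 2 pi.\<close>

lemma nondegenerate_1:
  assumes T: "T > 0" "\<forall>k::nat. T \<noteq> 2 * pi * real k"
  shows "nondegenerate T (\<lambda>t. 1)"
  unfolding nondegenerate_def
proof (intro allI impI)
  fix y t
  assume y: "has_second_derivative y (\<lambda>t. - 1 * y t)" "odd_periodic T y"
  have s: "has_second_derivative sin (\<lambda>t. - sin t :: real)"
    by (rule has_second_derivativeI[where v = cos]) (auto intro!: derivative_eq_intros)
  note L = has_second_derivative_lincomb[OF y(1) s, of 1 "- deriv y 0", simplified]
  have sin_deriv: "deriv sin (0::real) = 1"
    using DERIV_imp_deriv[OF DERIV_sin[of 0]] by simp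
  have eq: "y t - deriv y 0 * sin t = 0" for t
    by (rule second_order_zero[OF L(1), of 0])
       (simp_all add: L(2) odd_periodic_0[OF y(2)] sin_deriv abs_minus_commute)
  have "sin (T / 2) \<noteq> 0"
  proof
    assume "sin (T / 2) = 0"
    then obtain i :: int where i: "T / 2 = of_int i * pi"
      by (auto simp: sin_zero_iff_int2)
    then have "of_int i * pi > 0" using T(1) by linarith
    then have "i > 0" by (simp add: zero_less_mult_iff)
    then have "T = 2 * pi * real (nat i)" using i by simp
    then show False using T(2) by blast
  qed
  then have "deriv y 0 = 0"
    using eq[of "T / 2"] odd_periodic_half[OF y(2)] by simp
  then show "y t = 0" using eq[of t] by simp
qed

section \<open>The pendulum orbit and Sturm comparison\<close>

locale pendulum_breather =
  fixes T :: real and \<theta> :: "real \<Rightarrow> real"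
  assumes pendulum: "pendulum_solution \<theta>" and odd: "odd_fun \<theta>"
    and period: "has_minimal_period \<theta> T" and speed: "deriv \<theta> 0 > 0"
begin

lemma T_pos: "T > 0"
  using period by (simp add: has_minimal_period_def)

lemma ode: "has_second_derivative \<theta> (\<lambda>t. - sin (\<theta> t))"
  using pendulum unfolding pendulum_solution_def has_second_derivative_def
  by (auto simp: differentiable_def has_real_derivative_iff DERIV_deriv_iff_real_differentiable)

lemma odd_periodic_theta: "odd_periodic T \<theta>"
  using odd period has_second_derivative_continuous[OF ode]
  by (auto simp: odd_fun_def has_minimal_period_def periodic_fun_simple_def odd_periodic_def)

lemma theta_0: "\<theta> 0 = 0"
  by (rule odd_periodic_0[OF odd_periodic_theta])

lemma energy: "(deriv \<theta> t)\<^sup>2 / 2 - cos (\<theta> t) = (deriv \<theta> s)\<^sup>2 / 2 - cos (\<theta> s)"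
proof -
  note D = has_second_derivativeD[OF ode]
  have "((\<lambda>t. (deriv \<theta> t)\<^sup>2 / 2 - cos (\<theta> t)) has_real_derivative 0) (at t)" for t
    by (auto intro!: derivative_eq_intros D)
  then have "(\<lambda>t. (deriv \<theta> t)\<^sup>2 / 2 - cos (\<theta> t)) t = (\<lambda>t. (deriv \<theta> t)\<^sup>2 / 2 - cos (\<theta> t)) s"
    using DERIV_isconst_all by blast
  then show ?thesis .
qed

text \<open>A periodic orbit has a turning point \<open>z\<close>. If the orbit met an odd multiple
  of pi, the energy would be at least 1, and at \<open>z\<close> that forces
  \<open>cos (\<theta> z) = - 1\<close>: the orbit would rest at an equilibrium, hence be constant,
  against \<open>deriv \<theta> 0 > 0\<close>.\<close>

lemma cos_theta_ne: "cos (\<theta> t) \<noteq> - 1"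
proof
  assume t: "cos (\<theta> t) = - 1"
  obtain z where "\<theta> T - \<theta> 0 = (T - 0) * deriv \<theta> z"
    using MVT2[OF T_pos, of \<theta> "deriv \<theta>"] has_second_derivativeD[OF ode] by blast
  moreover have "\<theta> T = \<theta> 0"
    using odd_periodic_theta unfolding odd_periodic_def by (metis add_0)
  ultimately have z: "deriv \<theta> z = 0" using T_pos by simp
  then have "cos (\<theta> z) = - 1 - (deriv \<theta> t)\<^sup>2 / 2"
    using energy[of t z] t by simp
  then have "cos (\<theta> z) = - 1"
    using zero_le_power2[of "deriv \<theta> t"] cos_ge_minus_one[of "\<theta> z"] by linarith
  then have sz: "sin (\<theta> z) = 0"
    using sin_cos_squared_add[of "\<theta> z"] by simp
  have c: "has_second_derivative (\<lambda>t. \<theta> z) (\<lambda>t. 0)"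
    by (rule has_second_derivativeI[where v = "\<lambda>t. 0"]) auto
  note L = has_second_derivative_diff[OF ode c]
  have "\<theta> s - \<theta> z = 0" for s
  proof (rule second_order_zero[OF L(1), of z])
    show "\<bar>- sin (\<theta> t) - 0\<bar> \<le> \<bar>\<theta> t - \<theta> z\<bar>" for t
      using abs_sin_diff_le[of "\<theta> t" "\<theta> z"] sz by simp
  qed (simp_all add: L(2) z)
  then have "\<theta> = (\<lambda>s. \<theta> z)" by auto
  then have "deriv \<theta> 0 = 0" by (metis deriv_const)
  then show False using speed by simp
qed

text \<open>The range is connected and contains 0, so reaching absolute value pi would put pi or -pi
  into it, where cos is -1.\<close>

lemma abs_theta_less: "\<bar>\<theta> t\<bar> < pi"
proof (rule ccontr)
  assume "\<not> \<bar>\<theta> t\<bar> < pi"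
  have "connected (range \<theta>)"
    using has_second_derivative_continuous(1)[OF ode] connected_UNIV by (rule connected_continuous_image)
  then have I: "{a..b} \<subseteq> range \<theta>" if "a \<in> range \<theta>" "b \<in> range \<theta>" for a b
    using that by (rule connected_contains_Icc)
  have "0 \<in> range \<theta>" using theta_0 by (metis rangeI)
  with I[of 0 "\<theta> t"] I[of "\<theta> t" 0] \<open>\<not> \<bar>\<theta> t\<bar> < pi\<close> have "pi \<in> range \<theta> \<or> - pi \<in> range \<theta>"
    by (auto simp: subset_iff abs_if split: if_splits)
  then show False
    using cos_theta_ne by (metis cos_minus cos_pi imageE)
qed

text \<open>A zero \<open>s\<close> is a centre of antisymmetry, like \<open>0\<close>, hence \<open>2 s\<close> is a period.\<close>

lemma theta_ne_0:
  assumes "0 < s" "s < T / 2"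
  shows "\<theta> s \<noteq> 0"
proof
  assume s: "\<theta> s = 0"
  note R = has_second_derivative_reflect[OF ode, of "2 * s"]
  note L = has_second_derivative_lincomb[OF ode R(1), of 1 1, simplified]
  have *: "\<theta> t + \<theta> (2 * s - t) = 0" for t
  proof (rule second_order_zero[OF L(1), of s])
    show "\<bar>- sin (\<theta> t) - sin (\<theta> (2 * s - t))\<bar> \<le> \<bar>\<theta> t + \<theta> (2 * s - t)\<bar>" for t
      using abs_sin_diff_le[of "\<theta> t" "- \<theta> (2 * s - t)"] by simp
  qed (use s in \<open>simp_all add: L(2) R(2)\<close>)
  have "\<theta> (t + 2 * s) = \<theta> t" for t
    using *[of "- t"] odd by (simp add: odd_fun_def add.commute)
  then have "periodic_fun_simple \<theta> (2 * s)"
    by (rule periodic_fun_simple.intro)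
  then show False
    using assms period by (auto simp: has_minimal_period_def)
qed

lemma theta_pos:
  assumes "0 < s" "s < T / 2"
  shows "\<theta> s > 0"
proof (rule ccontr)
  assume "\<not> \<theta> s > 0"
  obtain r where r: "0 < r" "r < s" "\<theta> r > 0"
    using pos_after_zero[OF has_second_derivativeD(1)[OF ode] speed theta_0 assms(1)] by auto
  then obtain x where "r \<le> x" "x \<le> s" "\<theta> x = 0"
    using IVT_zero[OF has_second_derivative_continuous(1)[OF ode], of r s] \<open>\<not> \<theta> s > 0\<close> by auto
  then show False using theta_ne_0[of x] r assms by auto
qed

text \<open>Sturm comparison with \<open>\<theta>\<close>, a solution of \<open>y'' + (sin \<theta> / \<theta>) y = 0\<close> which is positive
  between its zeros \<open>0\<close> and \<open>T/2\<close>: the Wronskian \<open>\<theta>' y - \<theta> y'\<close> decreases up to the first zero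
  of \<open>y\<close>, where it would have to be nonnegative.\<close>

lemma sturm_comparison:
  assumes q: "\<And>t. 0 < t \<Longrightarrow> t < T / 2 \<Longrightarrow> q t * \<theta> t < sin (\<theta> t)"
    and y: "has_second_derivative y (\<lambda>t. - q t * y t)" "y 0 = 0" "deriv y 0 > 0"
  shows "y (T / 2) \<noteq> 0"
proof
  assume yT: "y (T / 2) = 0"
  note Dy = has_second_derivativeD[OF y(1)] and cy = has_second_derivative_continuous[OF y(1)]
  note Dt = has_second_derivativeD[OF ode] and ct = has_second_derivative_continuous[OF ode]
  obtain r where r: "0 < r" "r < T / 2" "\<forall>t. 0 < t \<longrightarrow> t \<le> r \<longrightarrow> y t > 0"
    using pos_after_zero[OF Dy(1) y(3,2), of "T / 2"] T_pos by auto
  then have r_pos: "y t > 0" if "0 < t" "t \<le> r" for t using that by blast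
  \<comment> \<open>Cutting off at \<open>r\<close> removes the zero of \<open>y\<close> at 0 and
    leaves a compact set of zeros, whose least element \<open>s\<close> is the first positive
    zero.\<close>
  define Z where "Z = {t \<in> {r..T / 2}. y t = 0}"
  have "closed Z" unfolding Z_def
    by (intro continuous_closed_preimage_constant continuous_on_subset[OF cy(1)]) auto
  moreover have "bounded Z"
    by (rule bounded_subset[of "{r..T / 2}"]) (auto simp: Z_def)
  ultimately have "compact Z" by (simp add: compact_eq_bounded_closed)
  moreover have "T / 2 \<in> Z" using yT r by (simp add: Z_def)
  ultimately obtain s where s: "s \<in> Z" "\<And>t. t \<in> Z \<Longrightarrow> s \<le> t"
    by (metis compact_attains_inf empty_iff)
  then have s': "r \<le> s" "s \<le> T / 2" "y s = 0" by (auto simp: Z_def)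
  have pos_r: "y t > 0" if t: "r \<le> t" "t < s" for t
  proof (rule ccontr)
    assume "\<not> y t > 0"
    then obtain x where "r \<le> x" "x \<le> t" "y x = 0"
      using IVT_zero[OF cy(1), of r t] r t by auto
    then show False using s(2)[of x] t s' by (auto simp: Z_def)
  qed
  have pos: "y t > 0" if "0 < t" "t < s" for t
    using pos_r[of t] r_pos[of t] that by linarith
  define W where "W = (\<lambda>t. deriv \<theta> t * y t - \<theta> t * deriv y t)"
  have dW: "(W has_real_derivative (q t * \<theta> t - sin (\<theta> t)) * y t) (at t)" for t
    unfolding W_def by (auto intro!: derivative_eq_intros Dy Dt simp: algebra_simps)
  have "W s < W 0"
  proof (rule DERIV_neg_imp_decreasing_open[where f = W and a = 0 and b = s])
    show "\<exists>d. (W has_real_derivative d) (at t) \<and> d < 0" if t: "0 < t" "t < s" for t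
    proof -
      have "q t * \<theta> t - sin (\<theta> t) < 0" using q[of t] t s' by simp
      then have "(q t * \<theta> t - sin (\<theta> t)) * y t < 0"
        using pos[OF t] by (simp add: mult_neg_pos)
      then show ?thesis using dW by blast
    qed
    show "continuous_on {0..s} W"
      unfolding W_def by (intro continuous_intros cy ct)
    show "0 < s" using r s' by simp
  qed
  then have "\<theta> s * deriv y s > 0"
    using s' y(2) theta_0 by (simp add: W_def)
  \<comment> \<open>The first zero may be T/2 itself, where \<theta> vanishes and the strict
    inequality just obtained is already absurd; nonnegativity treats both cases at once.\<close>
  moreover have "\<theta> s \<ge> 0"
    using theta_pos[of s] odd_periodic_half[OF odd_periodic_theta] s' r by (cases "s = T / 2") auto
  ultimately have "deriv y s > 0" by (simp add: zero_less_mult_iff)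
  then obtain e where e: "e > 0" "\<And>h. h > 0 \<Longrightarrow> h < e \<Longrightarrow> y (s - h) < y s"
    using DERIV_pos_inc_left[OF Dy(1)] by blast
  have "y (s - min e s / 2) < 0"
    using e(2)[of "min e s / 2"] e(1) r s' by auto
  moreover have "y (s - min e s / 2) > 0"
    using e(1) r s' by (intro pos) auto
  ultimately show False by simp
qed

text \<open>A kernel element vanishes at 0 and T/2. The comparison excludes a positive initial slope
  for it and for its negative, so all its initial data are zero.\<close>

lemma nondegenerate_sturm:
  assumes q: "\<And>t. 0 < t \<Longrightarrow> t < T / 2 \<Longrightarrow> q t * \<theta> t < sin (\<theta> t)" "\<And>t. \<bar>q t\<bar> \<le> 1"
  shows "nondegenerate T q"
  unfolding nondegenerate_def
proof (intro allI impI)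
  fix y t
  assume y: "has_second_derivative y (\<lambda>t. - q t * y t)" "odd_periodic T y"
  note y0 = odd_periodic_0[OF y(2)] and yT = odd_periodic_half[OF y(2)]
  note N = has_second_derivative_lincomb[OF y(1) y(1), of "-1" 0]
  have "\<not> deriv y 0 > 0"
    using sturm_comparison[OF q(1) y(1) y0] yT by blast
  moreover have "\<not> deriv y 0 < 0"
    using sturm_comparison[OF q(1), of "\<lambda>t. -1 * y t + 0 * y t"] N y0 yT by auto
  ultimately have 0: "deriv y 0 = 0" by simp
  show "y t = 0"
  proof (rule second_order_zero[OF y(1) _ y0 0])
    show "\<bar>- q t * y t\<bar> \<le> \<bar>y t\<bar>" for t
      using mult_right_mono[OF q(2)[of t] abs_ge_zero[of "y t"]] by (simp add: abs_mult)
  qed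
qed

lemma nondegenerate_cos: "nondegenerate T (\<lambda>t. cos (\<theta> t))"
  using theta_pos abs_theta_less mult_cos_less_sin
  by (intro nondegenerate_sturm) (auto simp: mult.commute abs_less_iff)

lemma nondegenerate_cos_half: "nondegenerate T (\<lambda>t. (1 + cos (\<theta> t)) / 2)"
proof (rule nondegenerate_sturm)
  show "(1 + cos (\<theta> t)) / 2 * \<theta> t < sin (\<theta> t)" if "0 < t" "t < T / 2" for t
    using theta_pos[OF that] abs_theta_less[of t] by (intro mult_cos_half_squared_less_sin) auto
  show "\<bar>(1 + cos (\<theta> t)) / 2\<bar> \<le> 1" for t
    by (rule abs_cos_half_le)
qed

end

section \<open>The nonlinearity\<close>

definition tdsg_rhs :: "real \<Rightarrow> real \<Rightarrow> real \<Rightarrow> real \<Rightarrow> real" where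
  "tdsg_rhs \<alpha> a b c = \<alpha> * cos b * (sin c + sin a) - (\<alpha> + 1 / 2) * sin b * (cos c + cos a)"

definition tdsg_field :: "real \<Rightarrow> (int \<Rightarrow> real \<Rightarrow> real) \<Rightarrow> int \<Rightarrow> real \<Rightarrow> real" where
  "tdsg_field \<alpha> \<Psi> n t = tdsg_rhs \<alpha> (\<Psi> (n - 1) t) (\<Psi> n t) (\<Psi> (n + 1) t)"

lemma TDSG_solution_iff:
  "TDSG_solution \<alpha> \<Psi> \<longleftrightarrow> (\<forall>n. has_second_derivative (\<Psi> n) (tdsg_field \<alpha> \<Psi> n))"
  unfolding TDSG_solution_def has_second_derivative_def tdsg_field_def tdsg_rhs_def
  by (auto simp: DERIV_deriv_iff_real_differentiable)

text \<open>In product-to-sum form every estimate reduces to sin in one variable, and the coupling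
  enters affinely, with a coefficient of absolute value at most 2.\<close>

lemma tdsg_rhs_eq:
  "tdsg_rhs \<alpha> a b c = \<alpha> * (sin (a - b) + sin (c - b))
     - (sin (b + a) + sin (b - a) + sin (b + c) + sin (b - c)) / 4"
  by (simp add: tdsg_rhs_def sin_add sin_diff algebra_simps)

lemma tdsg_rhs_minus: "tdsg_rhs \<alpha> (- a) (- b) (- c) = - tdsg_rhs \<alpha> a b c"
  by (simp add: tdsg_rhs_def algebra_simps)

lemma tdsg_rhs_0: "tdsg_rhs \<alpha> 0 0 0 = 0"
  by (simp add: tdsg_rhs_def)

lemma tdsg_rhs_coupling:
  "\<bar>tdsg_rhs \<alpha> a b c - tdsg_rhs \<beta> a b c\<bar> \<le> 2 * \<bar>\<alpha> - \<beta>\<bar>"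
proof -
  have "\<bar>tdsg_rhs \<alpha> a b c - tdsg_rhs \<beta> a b c\<bar> = \<bar>\<alpha> - \<beta>\<bar> * \<bar>sin (a - b) + sin (c - b)\<bar>"
    by (simp add: tdsg_rhs_eq left_diff_distrib flip: abs_mult)
  also have "\<dots> \<le> \<bar>\<alpha> - \<beta>\<bar> * 2"
    using abs_sin_le_one[of "a - b"] abs_sin_le_one[of "c - b"]
    by (intro mult_left_mono) linarith+
  finally show ?thesis by simp
qed

lemma tdsg_rhs_bounded: "\<bar>tdsg_rhs \<alpha> a b c\<bar> \<le> 2 * \<bar>\<alpha>\<bar> + 1"
proof -
  have "\<bar>x + y + z + w\<bar> \<le> 4"
    if "\<bar>x\<bar> \<le> 1" "\<bar>y\<bar> \<le> 1" "\<bar>z\<bar> \<le> 1" "\<bar>w\<bar> \<le> 1" for x y z w :: real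
    using that by linarith
  from this[OF abs_sin_le_one abs_sin_le_one abs_sin_le_one abs_sin_le_one]
  have "\<bar>tdsg_rhs 0 a b c\<bar> \<le> 1"
    by (simp add: tdsg_rhs_eq)
  then show ?thesis
    using tdsg_rhs_coupling[of \<alpha> a b c 0] unfolding diff_0_right by linarith
qed

lemma sin_coupling_lipschitz:
  fixes a b c :: real
  assumes "\<alpha> \<ge> 0" "\<bar>a - a'\<bar> \<le> d" "\<bar>b - b'\<bar> \<le> d" "\<bar>c - c'\<bar> \<le> d"
  shows "\<bar>\<alpha> * (sin (a - b) + sin (c - b)) - \<alpha> * (sin (a' - b') + sin (c' - b'))\<bar> \<le> 4 * \<alpha> * d"
proof -
  have "\<bar>sin (a - b) + sin (c - b) - (sin (a' - b') + sin (c' - b'))\<bar> \<le> 4 * d"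
    using abs_sin_diff_le[of "a - b" "a' - b'"] abs_sin_diff_le[of "c - b" "c' - b'"] assms(2-4)
    by linarith
  then have "\<alpha> * \<bar>sin (a - b) + sin (c - b) - (sin (a' - b') + sin (c' - b'))\<bar> \<le> \<alpha> * (4 * d)"
    by (rule mult_left_mono[OF _ assms(1)])
  then show ?thesis
    using assms(1) by (simp add: abs_mult mult_ac flip: right_diff_distrib)
qed

text \<open>Every sine has an argument moving by at most \<open>2 * d\<close>: two of them weighted
  by \<alpha>, four weighted by 1/4. It serves to compare second derivatives through the equation
  when continuity in the C^2 norm is proved.\<close>

lemma tdsg_rhs_lipschitz:
  assumes "\<alpha> \<ge> 0" "\<bar>a - a'\<bar> \<le> d" "\<bar>b - b'\<bar> \<le> d" "\<bar>c - c'\<bar> \<le> d"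
  shows "\<bar>tdsg_rhs \<alpha> a b c - tdsg_rhs \<alpha> a' b' c'\<bar> \<le> (4 * \<alpha> + 2) * d"
proof -
  have comb: "\<bar>l - p / 4 - q / 4\<bar> \<le> k + 2 * d"
    if "\<bar>l\<bar> \<le> k" "\<bar>p\<bar> \<le> 4 * d" "\<bar>q\<bar> \<le> 4 * d" for l p q k :: real
    using that by linarith
  let ?D = "\<lambda>x y x' y'. sin (x + y) + sin (x - y) - (sin (x' + y') + sin (x' - y'))"
  have D1: "\<bar>?D b a b' a'\<bar> \<le> 4 * d"
    using abs_sin_diff_le[of "b + a" "b' + a'"] abs_sin_diff_le[of "b - a" "b' - a'"] assms(2-4)
    by linarith
  have D2: "\<bar>?D b c b' c'\<bar> \<le> 4 * d"
    using abs_sin_diff_le[of "b + c" "b' + c'"] abs_sin_diff_le[of "b - c" "b' - c'"] assms(2-4)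
    by linarith
  show ?thesis
    using comb[OF sin_coupling_lipschitz[OF assms] D1 D2] by (simp add: tdsg_rhs_eq field_simps)
qed

text \<open>The function sin(X + z) - z cos X has derivative cos(X + z) - cos X, at most |z| in
  absolute value. The resulting Lipschitz constant \<delta> does not depend on the base point
  \<open>X\<close>.\<close>

lemma sin_linearization:
  fixes x x' :: real
  assumes "\<bar>x\<bar> \<le> \<delta>" "\<bar>x'\<bar> \<le> \<delta>"
  shows "\<bar>sin (X + x) - sin (X + x') - cos X * (x - x')\<bar> \<le> \<delta> * \<bar>x - x'\<bar>"
proof -
  have "norm ((\<lambda>z. sin (X + z) - cos X * z) x - (\<lambda>z. sin (X + z) - cos X * z) x') \<le> \<delta> * norm (x - x')"
  proof (rule field_differentiable_bound[of "{-\<delta>..\<delta>}"])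
    fix z assume z: "z \<in> {-\<delta>..\<delta>}"
    show "((\<lambda>z. sin (X + z) - cos X * z) has_field_derivative cos (X + z) - cos X) (at z within {-\<delta>..\<delta>})"
      by (auto intro!: derivative_eq_intros)
    have "\<bar>cos (X + z) - cos X\<bar> \<le> \<bar>z\<bar>"
      using abs_sin_diff_le[of "pi / 2 - (X + z)" "pi / 2 - X"] by (simp add: cos_sin_eq)
    then show "norm (cos (X + z) - cos X) \<le> \<delta>" using z by auto
  qed (use assms in auto)
  then show ?thesis by (simp add: algebra_simps)
qed

text \<open>At the one-site breather no two neighbours are both nonzero, so the linearization
  at coupling \<open>0\<close> is diagonal.\<close>

lemma tdsg_rhs_linearization:
  assumes \<alpha>: "\<alpha> \<ge> 0"
    and small: "\<bar>a\<bar> \<le> \<delta>" "\<bar>b\<bar> \<le> \<delta>" "\<bar>c\<bar> \<le> \<delta>" "\<bar>a'\<bar> \<le> \<delta>" "\<bar>b'\<bar> \<le> \<delta>" "\<bar>c'\<bar> \<le> \<delta>"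
    and d: "\<bar>a - a'\<bar> \<le> d" "\<bar>b - b'\<bar> \<le> d" "\<bar>c - c'\<bar> \<le> d"
    and center: "sin B * sin A = 0" "sin B * sin C = 0"
  shows "\<bar>tdsg_rhs \<alpha> (A + a) (B + b) (C + c) - tdsg_rhs \<alpha> (A + a') (B + b') (C + c')
     + cos B * (cos C + cos A) / 2 * (b - b')\<bar> \<le> 4 * (\<alpha> + \<delta>) * d"
proof -
  let ?S = "\<lambda>X x x'. sin (X + x) - sin (X + x') - cos X * (x - x')"
  have d0: "d \<ge> 0" and \<delta>0: "\<delta> \<ge> 0" using d small by auto
  \<comment> \<open>Arguments are sums or differences of two small quantities, so both the radius
    and the increment double, giving (2 \<delta>)(2 d); the average of four such terms keeps this
    size.\<close>
  have S: "\<bar>?S X x x'\<bar> \<le> 4 * \<delta> * d" if "\<bar>x\<bar> \<le> 2 * \<delta>" "\<bar>x'\<bar> \<le> 2 * \<delta>" "\<bar>x - x'\<bar> \<le> 2 * d" for X x x'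
  proof -
    have "\<bar>?S X x x'\<bar> \<le> 2 * \<delta> * \<bar>x - x'\<bar>" using that by (intro sin_linearization)
    also have "\<dots> \<le> 2 * \<delta> * (2 * d)" using that \<delta>0 by (intro mult_left_mono) auto
    finally show ?thesis by simp
  qed
  have sum: "\<bar>x + y\<bar> \<le> 2 * k" "\<bar>x - y\<bar> \<le> 2 * k" if "\<bar>x\<bar> \<le> k" "\<bar>y\<bar> \<le> k" for x y k :: real
    using that by linarith+
  have diff: "\<bar>(x + y) - (x' + y')\<bar> \<le> 2 * d" "\<bar>(x - y) - (x' - y')\<bar> \<le> 2 * d"
    if "\<bar>x - x'\<bar> \<le> d" "\<bar>y - y'\<bar> \<le> d" for x y x' y'
    using that by linarith+
  have four: "\<bar>x + y + z + w\<bar> \<le> 4 * k"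
    if "\<bar>x\<bar> \<le> k" "\<bar>y\<bar> \<le> k" "\<bar>z\<bar> \<le> k" "\<bar>w\<bar> \<le> k" for x y z w k :: real
    using that by linarith
  define s where "s = ?S (B + A) (b + a) (b' + a') + ?S (B - A) (b - a) (b' - a')
    + ?S (B + C) (b + c) (b' + c') + ?S (B - C) (b - c) (b' - c')"
  define l where "l = \<alpha> * (sin ((A + a) - (B + b)) + sin ((C + c) - (B + b)))
    - \<alpha> * (sin ((A + a') - (B + b')) + sin ((C + c') - (B + b')))"
  have "\<bar>s\<bar> \<le> 4 * (4 * \<delta> * d)"
    unfolding s_def by (intro four S sum diff small d)
  moreover have comb: "\<bar>l - x / 4\<bar> \<le> k + y" if "\<bar>l\<bar> \<le> k" "\<bar>x\<bar> \<le> 4 * y" for l x k y :: real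
    using that by linarith
  moreover have "\<bar>l\<bar> \<le> 4 * \<alpha> * d"
    unfolding l_def by (rule sin_coupling_lipschitz[OF \<alpha>]) (use d in auto)
  ultimately have le: "\<bar>l - s / 4\<bar> \<le> 4 * \<alpha> * d + 4 * \<delta> * d" by blast
  \<comment> \<open>The increments of the neighbour carry cos(B + X) - cos(B - X) = -2 sin B sin X,
    which is zero; those of the site itself carry 2 cos B cos X.\<close>
  have lin: "cos (B + X) * ((b + x) - (b' + x')) + cos (B - X) * ((b - x) - (b' - x'))
      = 2 * (cos B * cos X * (b - b'))"
    if "sin B * sin X = 0" for X x x'
    using that by (auto simp: cos_add cos_diff algebra_simps)
  have shift: "(B + b) + (X + x) = (B + X) + (b + x)" "(B + b) - (X + x) = (B - X) + (b - x)"
    for B b X x :: real by auto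
  have "s = sin (B + A + (b + a)) - sin (B + A + (b' + a')) + (sin (B - A + (b - a)) - sin (B - A + (b' - a')))
    + (sin (B + C + (b + c)) - sin (B + C + (b' + c'))) + (sin (B - C + (b - c)) - sin (B - C + (b' - c')))
    - (2 * (cos B * cos A * (b - b')) + 2 * (cos B * cos C * (b - b')))"
    unfolding s_def lin[OF center(1), of a a', symmetric] lin[OF center(2), of c c', symmetric]
    by simp
  then have "tdsg_rhs \<alpha> (A + a) (B + b) (C + c) - tdsg_rhs \<alpha> (A + a') (B + b') (C + c')
     + cos B * (cos C + cos A) / 2 * (b - b') = l - s / 4"
    unfolding tdsg_rhs_eq l_def shift by (simp add: field_simps)
  then show ?thesis using le by (simp add: algebra_simps)
qed

lemma odd_periodicD:
  assumes "odd_periodic T u"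
  shows "continuous_on UNIV u" "u (t + T) = u t" "u (- t) = - u t"
  using assms by (auto simp: odd_periodic_def)

lemma odd_periodic_add: "odd_periodic T u \<Longrightarrow> odd_periodic T v \<Longrightarrow> odd_periodic T (\<lambda>t. u t + v t)"
  by (auto simp: odd_periodic_def intro!: continuous_intros)

lemma odd_periodic_diff: "odd_periodic T u \<Longrightarrow> odd_periodic T v \<Longrightarrow> odd_periodic T (\<lambda>t. u t - v t)"
  by (auto simp: odd_periodic_def intro!: continuous_intros)

lemma odd_periodic_zero: "odd_periodic T (\<lambda>t. 0)"
  by (auto simp: odd_periodic_def)

lemma odd_periodic_tdsg_field:
  assumes "\<And>n. odd_periodic T (\<Psi> n)"
  shows "odd_periodic T (tdsg_field \<alpha> \<Psi> n)"
proof -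
  note [simp] = odd_periodicD(2,3)[OF assms]
  have "continuous_on UNIV (tdsg_field \<alpha> \<Psi> n)"
    unfolding tdsg_field_def[abs_def] tdsg_rhs_def
    by (intro continuous_intros odd_periodicD(1)[OF assms])
  then show ?thesis
    by (auto simp: odd_periodic_def tdsg_field_def tdsg_rhs_minus)
qed

text \<open>The step is applied with \<open>d\<close> the supremum of \<open>x\<close>. Since that
  supremum is finite, its half can be absorbed on the left.\<close>

lemma bounded_halving:
  fixes x :: "'a \<Rightarrow> real"
  assumes bdd: "\<And>i. x i \<le> K" and step: "\<And>d. (\<And>i. x i \<le> d) \<Longrightarrow> (\<And>i. x i \<le> d / 2 + e)"
  shows "x i \<le> 2 * e"
proof -
  have "bdd_above (range x)" using bdd by (intro bdd_aboveI[of _ K]) auto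
  then have le: "x i \<le> (SUP i. x i)" for i by (rule cSUP_upper[OF UNIV_I])
  have "(SUP i. x i) \<le> (SUP i. x i) / 2 + e"
    using step[OF le] by (intro cSUP_least) auto
  then show ?thesis using le[of i] by linarith
qed

section \<open>Uniform inverses and the remainder at the one-site breather\<close>

locale nonresonant_breather = pendulum_breather +
  assumes nonresonant: "\<forall>k::nat. T \<noteq> 2 * pi * real k"
begin

abbreviation \<Theta> :: "int \<Rightarrow> real \<Rightarrow> real" where
  "\<Theta> \<equiv> one_site_breather \<theta>"

text \<open>Minus the partial derivative of \<open>tdsg_rhs 0\<close> in its middle argument, taken
  at the one-site breather.\<close>

definition potential :: "int \<Rightarrow> real \<Rightarrow> real" where
  "potential n t = cos (\<Theta> n t) * (cos (\<Theta> (n + 1) t) + cos (\<Theta> (n - 1) t)) / 2"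

lemma potential_eq:
  "potential n = (if n = 0 then (\<lambda>t. cos (\<theta> t))
     else if \<bar>n\<bar> = 1 then (\<lambda>t. (1 + cos (\<theta> t)) / 2) else (\<lambda>t. 1))"
  by (auto simp: potential_def one_site_breather_def fun_eq_iff)

lemma odd_periodic_Theta: "odd_periodic T (\<Theta> n)"
  using odd_periodic_theta by (simp add: one_site_breather_def odd_periodic_zero)

lemma Theta_ode: "has_second_derivative (\<Theta> n) (tdsg_field 0 \<Theta> n)"
proof -
  have "tdsg_field 0 \<Theta> n = (if n = 0 then (\<lambda>t. - sin (\<theta> t)) else (\<lambda>t. 0))"
    by (auto simp: tdsg_field_def tdsg_rhs_def one_site_breather_def fun_eq_iff)
  then show ?thesis
    using ode has_second_derivative_zero by (simp add: one_site_breather_def)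
qed

lemma Theta_neighbours: "sin (\<Theta> n t) * sin (\<Theta> (n - 1) t) = 0" "sin (\<Theta> n t) * sin (\<Theta> (n + 1) t) = 0"
  by (auto simp: one_site_breather_def)

text \<open>\<open>potential_eq\<close> leaves only three functions, so the sum of their three
  constants works for every site.\<close>

lemma potential_solvable:
  "\<exists>M>0. \<forall>n. (\<forall>f. odd_periodic T f \<longrightarrow>
             (\<exists>w. odd_periodic T w \<and> has_second_derivative w (\<lambda>t. f t - potential n t * w t))) \<and>
           (\<forall>w f c t. odd_periodic T w \<longrightarrow> has_second_derivative w (\<lambda>t. f t - potential n t * w t) \<longrightarrow>
             continuous_on UNIV f \<longrightarrow> (\<forall>t. \<bar>f t\<bar> \<le> c) \<longrightarrow> \<bar>w t\<bar> \<le> M * c)"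
proof -
  define S where "S = (\<lambda>q M. (\<forall>f. odd_periodic T f \<longrightarrow>
             (\<exists>w. odd_periodic T w \<and> has_second_derivative w (\<lambda>t. f t - q t * w t))) \<and>
           (\<forall>w f c t. odd_periodic T w \<longrightarrow> has_second_derivative w (\<lambda>t. f t - q t * w t) \<longrightarrow>
             continuous_on UNIV f \<longrightarrow> (\<forall>t. \<bar>f t\<bar> \<le> c) \<longrightarrow> \<bar>w t\<bar> \<le> M * c))"
  have mono: "S q M'" if "S q M" "M \<le> M'" for q M M'
    unfolding S_def
  proof (intro conjI allI impI)
    fix w f c t
    assume *: "odd_periodic T w" "has_second_derivative w (\<lambda>t. f t - q t * w t)"
      "continuous_on UNIV f" "\<forall>t. \<bar>f t\<bar> \<le> c"
    have "c \<ge> 0" using order_trans[OF abs_ge_zero, of "f 0" c] * by blast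
    then have "M * c \<le> M' * c" using that(2) by (rule mult_right_mono[rotated])
    moreover have "\<bar>w t\<bar> \<le> M * c" using that(1) * unfolding S_def by blast
    ultimately show "\<bar>w t\<bar> \<le> M' * c" by simp
  qed (use that(1) in \<open>auto simp: S_def\<close>)
  note [simp] = odd_periodicD(2,3)[OF odd_periodic_theta]
  note cont = odd_periodicD(1)[OF odd_periodic_theta]
  have "\<exists>M>0. S (\<lambda>t. cos (\<theta> t)) M"
    unfolding S_def by (rule nondegenerate_solvable[OF T_pos _ _ _ _ nondegenerate_cos])
      (use cont in \<open>auto intro!: continuous_intros\<close>)
  then obtain M0 where M0: "M0 > 0" "S (\<lambda>t. cos (\<theta> t)) M0" by blast
  have "\<exists>M>0. S (\<lambda>t. (1 + cos (\<theta> t)) / 2) M"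
    unfolding S_def by (rule nondegenerate_solvable[OF T_pos _ abs_cos_half_le _ _ nondegenerate_cos_half])
      (use cont in \<open>auto intro!: continuous_intros\<close>)
  then obtain M1 where M1: "M1 > 0" "S (\<lambda>t. (1 + cos (\<theta> t)) / 2) M1" by blast
  have "\<exists>M>0. S (\<lambda>t. 1) M"
    unfolding S_def by (rule nondegenerate_solvable[OF T_pos _ _ _ _ nondegenerate_1[OF T_pos nonresonant]])
      auto
  then obtain M2 where M2: "M2 > 0" "S (\<lambda>t. 1) M2" by blast
  have "S (potential n) (M0 + M1 + M2)" for n
    using mono[OF M0(2)] mono[OF M1(2)] mono[OF M2(2)] M0(1) M1(1) M2(1)
    by (simp add: potential_eq)
  then show ?thesis
    unfolding S_def using M0(1) M1(1) M2(1) by (intro exI[of _ "M0 + M1 + M2"]) auto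
qed

definition M :: real where
  "M = (SOME M. M > 0 \<and> (\<forall>n. (\<forall>f. odd_periodic T f \<longrightarrow>
             (\<exists>w. odd_periodic T w \<and> has_second_derivative w (\<lambda>t. f t - potential n t * w t))) \<and>
           (\<forall>w f c t. odd_periodic T w \<longrightarrow> has_second_derivative w (\<lambda>t. f t - potential n t * w t) \<longrightarrow>
             continuous_on UNIV f \<longrightarrow> (\<forall>t. \<bar>f t\<bar> \<le> c) \<longrightarrow> \<bar>w t\<bar> \<le> M * c)))"

lemma M_pos: "M > 0"
  and potential_solution_exists:
    "odd_periodic T f \<Longrightarrow> \<exists>w. odd_periodic T w \<and> has_second_derivative w (\<lambda>t. f t - potential n t * w t)"
  and potential_solution_bound:
    "odd_periodic T w \<Longrightarrow> has_second_derivative w (\<lambda>t. f t - potential n t * w t) \<Longrightarrow>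
       continuous_on UNIV f \<Longrightarrow> (\<And>t. \<bar>f t\<bar> \<le> c) \<Longrightarrow> \<bar>w t\<bar> \<le> M * c"
  using someI_ex[OF potential_solvable, folded M_def] by blast+

text \<open>What remains of the equation for \<phi> once the equation of the one-site breather is
  subtracted and the linear part at coupling 0 is split off; it is both the effect of the coupling
  and the higher-order terms.\<close>

definition remainder :: "real \<Rightarrow> (int \<Rightarrow> real \<Rightarrow> real) \<Rightarrow> int \<Rightarrow> real \<Rightarrow> real" where
  "remainder \<alpha> \<phi> n t = tdsg_field \<alpha> (\<lambda>n t. \<Theta> n t + \<phi> n t) n t - tdsg_field 0 \<Theta> n t + potential n t * \<phi> n t"

lemma odd_periodic_remainder:
  assumes "\<And>n. odd_periodic T (\<phi> n)"
  shows "odd_periodic T (remainder \<alpha> \<phi> n)"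
proof -
  have "odd_periodic T (tdsg_field \<alpha> (\<lambda>n t. \<Theta> n t + \<phi> n t) n)"
    by (intro odd_periodic_tdsg_field odd_periodic_add odd_periodic_Theta assms)
  moreover have "odd_periodic T (tdsg_field 0 \<Theta> n)"
    by (intro odd_periodic_tdsg_field odd_periodic_Theta)
  moreover have "odd_periodic T (\<lambda>t. potential n t * \<phi> n t)"
  proof -
    note [simp] = odd_periodicD(2,3)[OF odd_periodic_Theta] odd_periodicD(2,3)[OF assms]
    have "continuous_on UNIV (\<lambda>t. potential n t * \<phi> n t)"
      unfolding potential_def
      by (intro continuous_intros odd_periodicD(1)[OF odd_periodic_Theta] odd_periodicD(1)[OF assms]) auto
    then show ?thesis by (auto simp: odd_periodic_def potential_def)
  qed
  ultimately have "odd_periodic T (\<lambda>t. tdsg_field \<alpha> (\<lambda>n t. \<Theta> n t + \<phi> n t) n t - tdsg_field 0 \<Theta> n t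
      + potential n t * \<phi> n t)"
    by (intro odd_periodic_add odd_periodic_diff)
  then show ?thesis by (simp add: remainder_def[abs_def])
qed

text \<open>Smallness \<delta> is global, but the distance \<open>d\<close> is asked only at sites
  within 1 of \<open>n\<close>; this locality is what later yields decay. The change of coupling is
  split off separately, at fixed \<eta>.\<close>

lemma remainder_lipschitz:
  assumes "\<alpha> \<ge> 0" "\<And>n t. \<bar>\<phi> n t\<bar> \<le> \<delta>" "\<And>n t. \<bar>\<eta> n t\<bar> \<le> \<delta>"
    and "\<And>m. \<bar>m - n\<bar> \<le> 1 \<Longrightarrow> \<bar>\<phi> m t - \<eta> m t\<bar> \<le> d"
  shows "\<bar>remainder \<alpha> \<phi> n t - remainder \<beta> \<eta> n t\<bar> \<le> 4 * (\<alpha> + \<delta>) * d + 2 * \<bar>\<alpha> - \<beta>\<bar>"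
proof -
  have "remainder \<alpha> \<phi> n t - remainder \<alpha> \<eta> n t
      = tdsg_rhs \<alpha> (\<Theta> (n - 1) t + \<phi> (n - 1) t) (\<Theta> n t + \<phi> n t) (\<Theta> (n + 1) t + \<phi> (n + 1) t)
      - tdsg_rhs \<alpha> (\<Theta> (n - 1) t + \<eta> (n - 1) t) (\<Theta> n t + \<eta> n t) (\<Theta> (n + 1) t + \<eta> (n + 1) t)
      + cos (\<Theta> n t) * (cos (\<Theta> (n + 1) t) + cos (\<Theta> (n - 1) t)) / 2 * (\<phi> n t - \<eta> n t)"
    unfolding remainder_def tdsg_field_def potential_def by (simp add: right_diff_distrib)
  also have "\<bar>\<dots>\<bar> \<le> 4 * (\<alpha> + \<delta>) * d"
    by (rule tdsg_rhs_linearization) (use assms Theta_neighbours in auto)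
  finally have "\<bar>remainder \<alpha> \<phi> n t - remainder \<alpha> \<eta> n t\<bar> \<le> 4 * (\<alpha> + \<delta>) * d" .
  moreover have "\<bar>remainder \<alpha> \<eta> n t - remainder \<beta> \<eta> n t\<bar> \<le> 2 * \<bar>\<alpha> - \<beta>\<bar>"
    unfolding remainder_def tdsg_field_def using tdsg_rhs_coupling by simp
  ultimately show ?thesis by linarith
qed

end

section \<open>Function spaces\<close>

text \<open>On [t, t + 1] some point has slope at most \<open>2 * a\<close> in absolute value, and
  moving back to \<open>t\<close> changes the slope by at most \<open>b\<close>. Hence C^2 norms
  need no separate estimate of first derivatives.\<close>

lemma deriv_bound:
  assumes u: "has_second_derivative u g" "\<And>t. \<bar>u t\<bar> \<le> a" "\<And>t. \<bar>g t\<bar> \<le> b"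
  shows "\<bar>deriv u t\<bar> \<le> 2 * a + b"
proof -
  note D = has_second_derivativeD[OF u(1)]
  obtain z where z: "t < z" "z < t + 1" "u (t + 1) - u t = (t + 1 - t) * deriv u z"
    using MVT2[of t "t + 1" u "deriv u"] D(1) by auto
  obtain y where y: "deriv u z - deriv u t = (z - t) * g y"
    using MVT2[of t z "deriv u" g] D(2) z(1) by blast
  have "\<bar>(z - t) * g y\<bar> \<le> 1 * b"
    unfolding abs_mult using u(3)[of y] z by (intro mult_mono) auto
  moreover have "\<bar>deriv u z\<bar> \<le> 2 * a"
    using z(3) u(2)[of t] u(2)[of "t + 1"] by simp
  ultimately show ?thesis using y by linarith
qed

lemma C2_odd_periodicD:
  assumes "u \<in> C2_odd_periodic T"
  shows "odd_periodic T u" "has_second_derivative u (deriv (deriv u))"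
    "continuous_on UNIV (deriv (deriv u))"
proof -
  have *: "(f has_real_derivative deriv f t) (at t)" if "f differentiable_on UNIV" for f :: "real \<Rightarrow> real" and t
    using that by (simp add: differentiable_on_def DERIV_deriv_iff_real_differentiable)
  show u: "has_second_derivative u (deriv (deriv u))"
    using assms * by (auto simp: C2_odd_periodic_def C2_def has_second_derivative_def)
  show "odd_periodic T u"
    using assms has_second_derivative_continuous(1)[OF u]
    by (auto simp: C2_odd_periodic_def odd_periodic_def odd_fun_def periodic_fun_simple_def)
  show "continuous_on UNIV (deriv (deriv u))"
    using assms by (simp add: C2_odd_periodic_def C2_def)
qed

lemma C2_odd_periodicI:
  assumes "odd_periodic T u" "has_second_derivative u g" "continuous_on UNIV g"
  shows "u \<in> C2_odd_periodic T"
proof -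
  note D = has_second_derivativeD[OF assms(2)]
  have "u differentiable_on UNIV" "deriv u differentiable_on UNIV"
    using D by (auto simp: differentiable_on_def real_differentiable_def)
  then show ?thesis
    using assms has_second_derivative_deriv_deriv[OF assms(2)]
    by (simp add: C2_odd_periodic_def C2_def odd_periodic_def odd_fun_def periodic_fun_simple_def)
qed

lemma C2_odd_periodic_diff:
  assumes "u \<in> C2_odd_periodic T" "v \<in> C2_odd_periodic T"
  shows "(\<lambda>t. u t - v t) \<in> C2_odd_periodic T"
  by (rule C2_odd_periodicI[OF odd_periodic_diff has_second_derivative_diff(1)])
     (auto intro!: continuous_intros C2_odd_periodicD[OF assms(1)] C2_odd_periodicD[OF assms(2)])

lemma deriv_periodic:
  assumes "\<And>t. (u has_real_derivative deriv u t) (at t)" "\<And>t. u (t + T) = u t"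
  shows "deriv u (t + T) = deriv u t"
proof -
  have "((\<lambda>t. u (t + T)) has_real_derivative deriv u (t + T)) (at t)"
    using assms(1) DERIV_shift by blast
  then show ?thesis
    using assms(2) by (simp add: DERIV_imp_deriv)
qed

lemma C2_norm_bdd_above:
  assumes T: "T > 0" and u: "u \<in> C2_odd_periodic T"
  shows "bdd_above (range (\<lambda>t. max \<bar>u t\<bar> (max \<bar>deriv u t\<bar> \<bar>deriv (deriv u) t\<bar>)))"
proof -
  note D = C2_odd_periodicD[OF u]
  note D' = has_second_derivativeD[OF D(2)] and c = has_second_derivative_continuous[OF D(2)]
  note p = odd_periodicD(2)[OF D(1)]
  note p1 = deriv_periodic[OF D'(1) p]
  note p2 = deriv_periodic[OF D'(2) p1]
  obtain a0 a1 a2 where a: "\<And>t. \<bar>u t\<bar> \<le> a0" "\<And>t. \<bar>deriv u t\<bar> \<le> a1" "\<And>t. \<bar>deriv (deriv u) t\<bar> \<le> a2"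
    using periodic_bounded[OF T c(1) p] periodic_bounded[OF T c(2) p1] periodic_bounded[OF T D(3) p2]
    by blast
  then show ?thesis
    by (intro bdd_aboveI2[where M = "max a0 (max a1 a2)"] max.mono)
qed

lemma C2_norm_upper:
  assumes "T > 0" "u \<in> C2_odd_periodic T"
  shows "\<bar>u t\<bar> \<le> C2_norm u" "\<bar>deriv u t\<bar> \<le> C2_norm u" "\<bar>deriv (deriv u) t\<bar> \<le> C2_norm u"
proof -
  have "max \<bar>u t\<bar> (max \<bar>deriv u t\<bar> \<bar>deriv (deriv u) t\<bar>) \<le> C2_norm u"
    unfolding C2_norm_def by (rule cSUP_upper[OF UNIV_I C2_norm_bdd_above[OF assms]])
  then show "\<bar>u t\<bar> \<le> C2_norm u" "\<bar>deriv u t\<bar> \<le> C2_norm u" "\<bar>deriv (deriv u) t\<bar> \<le> C2_norm u"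
    by auto
qed

lemma C2_norm_le:
  assumes "has_second_derivative u g" "\<And>t. \<bar>u t\<bar> \<le> a" "\<And>t. \<bar>g t\<bar> \<le> b"
  shows "C2_norm u \<le> 2 * a + b"
  unfolding C2_norm_def
proof (rule cSUP_least)
  fix t
  have "a \<ge> 0" "b \<ge> 0" using assms(2,3) order_trans[OF abs_ge_zero] by blast+
  then show "max \<bar>u t\<bar> (max \<bar>deriv u t\<bar> \<bar>deriv (deriv u) t\<bar>) \<le> 2 * a + b"
    using assms(2)[of t] assms(3)[of t] deriv_bound[OF assms, of t]
      has_second_derivative_deriv_deriv[OF assms(1)] by simp
qed simp

lemma C2_norm_diff_le:
  assumes T: "T > 0" and u: "u \<in> C2_odd_periodic T" and v: "v \<in> C2_odd_periodic T"
  shows "C2_norm (\<lambda>t. u t - v t) \<le> 2 * (C2_norm u + C2_norm v) + (C2_norm u + C2_norm v)"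
proof (rule C2_norm_le)
  show "has_second_derivative (\<lambda>t. u t - v t) (\<lambda>t. deriv (deriv u) t - deriv (deriv v) t)"
    by (rule has_second_derivative_diff(1)[OF C2_odd_periodicD(2)[OF u] C2_odd_periodicD(2)[OF v]])
  show "\<bar>u t - v t\<bar> \<le> C2_norm u + C2_norm v" for t
    using C2_norm_upper(1)[OF T u, of t] C2_norm_upper(1)[OF T v, of t] by linarith
  show "\<bar>deriv (deriv u) t - deriv (deriv v) t\<bar> \<le> C2_norm u + C2_norm v" for t
    using C2_norm_upper(3)[OF T u, of t] C2_norm_upper(3)[OF T v, of t] by linarith
qed

lemma OmegaD:
  assumes "\<Psi> \<in> Omega T"
  shows "\<Psi> n \<in> C2_odd_periodic T" "bdd_above (range (\<lambda>n. C2_norm (\<Psi> n)))"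
  using assms by (auto simp: Omega_def)

text \<open>Ensures that \<open>Omega_norm\<close> of a difference is a supremum of a bounded set,
  hence a genuine upper bound.\<close>

lemma Omega_diff:
  assumes T: "T > 0" and u: "\<Psi> \<in> Omega T" and v: "\<Phi> \<in> Omega T"
  shows "(\<lambda>n t. \<Psi> n t - \<Phi> n t) \<in> Omega T"
proof -
  obtain K L where KL: "\<And>n. C2_norm (\<Psi> n) \<le> K" "\<And>n. C2_norm (\<Phi> n) \<le> L"
    using OmegaD(2)[OF u] OmegaD(2)[OF v] unfolding bdd_above_def by blast
  have "C2_norm (\<lambda>t. \<Psi> n t - \<Phi> n t) \<le> 3 * (K + L)" for n
    by (rule order_trans[OF C2_norm_diff_le[OF T OmegaD(1)[OF u] OmegaD(1)[OF v]]])
       (use KL[of n] in \<open>simp add: algebra_simps\<close>)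
  then show ?thesis
    using C2_odd_periodic_diff[OF OmegaD(1)[OF u] OmegaD(1)[OF v]]
    by (auto simp: Omega_def intro!: bdd_aboveI[of _ "3 * (K + L)"])
qed

lemma Omega_norm_upper:
  assumes "T > 0" "\<Psi> \<in> Omega T"
  shows "\<bar>\<Psi> n t\<bar> \<le> Omega_norm \<Psi>"
proof -
  have "C2_norm (\<Psi> n) \<le> Omega_norm \<Psi>"
    unfolding Omega_norm_def by (rule cSUP_upper[OF UNIV_I OmegaD(2)[OF assms(2)]])
  then show ?thesis
    using C2_norm_upper(1)[OF assms(1) OmegaD(1)[OF assms(2)], of n t] by linarith
qed

section \<open>Fixed points for sequences of functions\<close>

lemma continuous_on_discrete_prod:
  fixes f :: "int \<Rightarrow> real \<Rightarrow> real"
  assumes "\<And>n. continuous_on UNIV (f n)"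
  shows "continuous_on UNIV (\<lambda>p. f (fst p) (snd p))"
proof -
  have "continuous_on (\<Union>n. {n} \<times> UNIV) (\<lambda>p. f (fst p) (snd p))"
  proof (rule continuous_on_open_UN)
    show "continuous_on ({n} \<times> UNIV) (\<lambda>p. f (fst p) (snd p))" for n
    proof (rule continuous_on_eq)
      show "continuous_on ({n} \<times> UNIV) (\<lambda>p. f n (snd p))"
        by (rule continuous_on_compose2[OF assms]) (auto intro!: continuous_intros)
    qed auto
  qed (auto intro: open_Times open_discrete)
  moreover have "(\<Union>n. {n} \<times> UNIV) = (UNIV :: (int \<times> real) set)" by auto
  ultimately show ?thesis by simp
qed

text \<open>The library makes \<open>'a \<Rightarrow>\<^sub>C 'b\<close> a complete space only for metric \<open>'a\<close>,
  which excludes the domain \<open>int \<times> real\<close>.\<close>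

lemma closed_imp_complete_bcontfun:
  fixes X :: "('a::topological_space \<Rightarrow>\<^sub>C 'b::complete_space) set"
  assumes "closed X"
  shows "complete X"
  unfolding complete_def
proof (intro allI impI, elim conjE)
  fix f :: "nat \<Rightarrow> ('a \<Rightarrow>\<^sub>C 'b)"
  assume f: "\<forall>n. f n \<in> X" and "Cauchy f"
  have "\<exists>N. \<forall>m n x. N \<le> m \<and> N \<le> n \<and> True \<longrightarrow> dist (f m x) (f n x) < e" if e: "e > 0" for e
  proof -
    obtain N where N: "\<And>m n. m \<ge> N \<Longrightarrow> n \<ge> N \<Longrightarrow> dist (f m) (f n) < e"
      using \<open>Cauchy f\<close> e unfolding Cauchy_def by blast
    show ?thesis
      using dist_bounded[of "f _" _ "f _"] by (intro exI[of _ N]) (blast intro: le_less_trans N)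
  qed
  then obtain g where "uniform_limit UNIV (\<lambda>n. apply_bcontfun (f n)) g sequentially"
    using uniformly_convergent_eq_cauchy[of "\<lambda>_. True" "\<lambda>n. apply_bcontfun (f n)"]
    unfolding uniform_limit_sequentially_iff by auto
  from uniform_limit_bcontfunE[OF this sequentially_bot]
  obtain l where "f \<longlonglongrightarrow> l" by blast
  then show "\<exists>l\<in>X. f \<longlonglongrightarrow> l"
    using closed_sequentially[OF assms] f by blast
qed

text \<open>A sequence of functions is viewed as one bounded continuous function on
  \<open>int \<times> real\<close>, so the supremum over sites and times becomes the distance of a
  complete space. The pointwise bound \<open>d\<close> in the contraction hypothesis is then
  instantiated by that distance.\<close>

lemma bounded_family_fixed_point:
  fixes \<Phi> :: "(int \<Rightarrow> real \<Rightarrow> real) \<Rightarrow> int \<Rightarrow> real \<Rightarrow> real"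
  assumes \<delta>: "\<delta> \<ge> 0"
    and maps: "\<And>\<phi> n. (\<And>n. odd_periodic T (\<phi> n)) \<Longrightarrow> (\<And>n t. \<bar>\<phi> n t\<bar> \<le> \<delta>) \<Longrightarrow>
      odd_periodic T (\<Phi> \<phi> n) \<and> (\<forall>t. \<bar>\<Phi> \<phi> n t\<bar> \<le> \<delta>)"
    and contr: "\<And>\<phi> \<eta> d n t. (\<And>n. odd_periodic T (\<phi> n)) \<Longrightarrow> (\<And>n t. \<bar>\<phi> n t\<bar> \<le> \<delta>) \<Longrightarrow>
      (\<And>n. odd_periodic T (\<eta> n)) \<Longrightarrow> (\<And>n t. \<bar>\<eta> n t\<bar> \<le> \<delta>) \<Longrightarrow>
      (\<And>n t. \<bar>\<phi> n t - \<eta> n t\<bar> \<le> d) \<Longrightarrow> \<bar>\<Phi> \<phi> n t - \<Phi> \<eta> n t\<bar> \<le> d / 2"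
  shows "\<exists>\<phi>. (\<forall>n. odd_periodic T (\<phi> n)) \<and> (\<forall>n t. \<bar>\<phi> n t\<bar> \<le> \<delta>) \<and> \<Phi> \<phi> = \<phi>"
proof -
  define fam :: "((int \<times> real) \<Rightarrow>\<^sub>C real) \<Rightarrow> int \<Rightarrow> real \<Rightarrow> real" where
    "fam v n t = apply_bcontfun v (n, t)" for v n t
  define X where "X = {v. (\<forall>n. odd_periodic T (fam v n)) \<and> (\<forall>n t. \<bar>fam v n t\<bar> \<le> \<delta>)}"
  have XD: "odd_periodic T (fam v n)" "\<bar>fam v n t\<bar> \<le> \<delta>" if "v \<in> X" for v n t
    using that by (auto simp: X_def)
  define F where "F v = Bcontfun (\<lambda>p. \<Phi> (fam v) (fst p) (snd p))" for v
  have "(\<lambda>p. \<Phi> (fam v) (fst p) (snd p)) \<in> bcontfun" if v: "v \<in> X" for v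
    by (rule bcontfun_normI[of _ \<delta>], rule continuous_on_discrete_prod)
       (use maps[OF XD[OF v]] in \<open>auto simp: odd_periodic_def\<close>)
  then have F: "fam (F v) = \<Phi> (fam v)" if "v \<in> X" for v
    using that by (auto simp: F_def fam_def Bcontfun_inverse fun_eq_iff)
  have ev: "continuous_on UNIV (\<lambda>v. fam v n t)" for n t
  proof (rule continuous_onI)
    fix v :: "(int \<times> real) \<Rightarrow>\<^sub>C real" and e :: real
    assume "e > 0"
    moreover have "dist (fam v' n t) (fam v n t) \<le> dist v' v" for v'
      by (simp add: fam_def dist_bounded)
    ultimately show "\<exists>d>0. \<forall>v'\<in>UNIV. dist v' v < d \<longrightarrow> dist (fam v' n t) (fam v n t) \<le> e"
      by (meson less_imp_le order_trans)
  qed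
  have "closed X"
  proof -
    have cont: "continuous_on UNIV (fam v n)" for v n
      unfolding fam_def
      by (rule continuous_on_compose2[OF continuous_on_apply_bcontfun]) (auto intro!: continuous_intros)
    \<comment> \<open>Continuity of each component is automatic, so only equations and inequalities
      between evaluations remain, and evaluations are continuous.\<close>
    have "X = (\<Inter>n. \<Inter>t. {v. fam v n (t + T) = fam v n t} \<inter> {v. fam v n (- t) = - fam v n t}
        \<inter> {v. \<bar>fam v n t\<bar> \<le> \<delta>})"
      using cont by (auto simp: X_def odd_periodic_def)
    then show ?thesis
      by (simp only:) (intro closed_INT ballI closed_Int closed_Collect_eq closed_Collect_le
          continuous_intros ev)
  qed
  have "\<exists>!v\<in>X. F v = v"
  proof (rule Banach_fix[where c = "1/2"])
    show "complete X" using \<open>closed X\<close> by (rule closed_imp_complete_bcontfun)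
    have "fam 0 n = (\<lambda>t. 0)" for n by (auto simp: fam_def)
    then have "0 \<in> X" using \<delta> by (simp add: X_def odd_periodic_zero)
    then show "X \<noteq> {}" by blast
    have "F v \<in> X" if v: "v \<in> X" for v
      using maps[OF XD[OF v]] unfolding X_def by (simp add: F[OF v])
    then show "F ` X \<subseteq> X" by blast
    show "dist (F v) (F w) \<le> 1/2 * dist v w" if "v \<in> X" "w \<in> X" for v w
    proof (rule dist_bound)
      fix p :: "int \<times> real"
      have "\<bar>\<Phi> (fam v) (fst p) (snd p) - \<Phi> (fam w) (fst p) (snd p)\<bar> \<le> dist v w / 2"
        by (rule contr[OF XD[OF that(1)] XD[OF that(2)]])
           (auto simp: fam_def dist_bounded simp flip: dist_real_def)
      then show "dist (apply_bcontfun (F v) p) (apply_bcontfun (F w) p) \<le> 1/2 * dist v w"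
        using F[OF that(1)] F[OF that(2)] by (cases p) (simp add: dist_real_def fam_def fun_eq_iff)
    qed
  qed auto
  then obtain v where v: "v \<in> X" "F v = v" by blast
  then show ?thesis
    using F[OF v(1)] XD[OF v(1)] by (intro exI[of _ "fam v"]) simp
qed

section \<open>Continuation of the breather\<close>

context nonresonant_breather
begin

definition small_correction :: "real \<Rightarrow> real \<Rightarrow> (int \<Rightarrow> real \<Rightarrow> real) \<Rightarrow> bool" where
  "small_correction \<alpha> \<delta> \<phi> \<longleftrightarrow> (\<forall>n. odd_periodic T (\<phi> n)) \<and> (\<forall>n t. \<bar>\<phi> n t\<bar> \<le> \<delta>) \<and>
     (\<forall>n. has_second_derivative (\<phi> n) (\<lambda>t. remainder \<alpha> \<phi> n t - potential n t * \<phi> n t))"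

text \<open>Adding or subtracting the equation of the one-site breather at coupling 0 passes between
  the two systems, as the potential terms cancel against those in \<open>remainder\<close>.\<close>

lemma small_correction_iff:
  "small_correction \<alpha> \<delta> \<phi> \<longleftrightarrow> (\<forall>n. odd_periodic T (\<phi> n)) \<and> (\<forall>n t. \<bar>\<phi> n t\<bar> \<le> \<delta>) \<and>
     TDSG_solution \<alpha> (\<lambda>n t. \<Theta> n t + \<phi> n t)"
proof -
  have eq: "(\<lambda>t. remainder \<alpha> \<phi> n t - potential n t * \<phi> n t)
      = (\<lambda>t. tdsg_field \<alpha> (\<lambda>n t. \<Theta> n t + \<phi> n t) n t - tdsg_field 0 \<Theta> n t)" for n
    by (simp add: remainder_def)
  have "has_second_derivative (\<phi> n) (\<lambda>t. tdsg_field \<alpha> (\<lambda>n t. \<Theta> n t + \<phi> n t) n t - tdsg_field 0 \<Theta> n t)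
      \<longleftrightarrow> has_second_derivative (\<lambda>t. \<Theta> n t + \<phi> n t) (tdsg_field \<alpha> (\<lambda>n t. \<Theta> n t + \<phi> n t) n)" (is "?L \<longleftrightarrow> ?R") for n
  proof
    assume ?L
    from has_second_derivative_lincomb(1)[OF Theta_ode[of n] this, of 1 1] show ?R by simp
  next
    assume ?R
    from has_second_derivative_diff(1)[OF this Theta_ode[of n]] show ?L by simp
  qed
  then show ?thesis
    by (simp add: small_correction_def TDSG_solution_iff eq)
qed

lemma halving_estimate:
  assumes "M * (4 * (\<alpha> + \<delta>)) \<le> 1 / 2" "d \<ge> 0"
  shows "M * (4 * (\<alpha> + \<delta>) * d + 2 * e) \<le> d / 2 + 2 * M * e"
  using mult_right_mono[OF assms] by (simp add: algebra_simps)

text \<open>The functions \<open>w\<close> and \<open>v\<close> are obtained from \<phi> and \<eta>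
  by one linear solve and need not be their components at \<open>n\<close>. So the same estimate
  covers one step of the iteration and, with \<open>w = \<phi> n\<close> and
  \<open>v = \<eta> n\<close>, actual solutions.\<close>

lemma local_comparison:
  assumes \<alpha>: "\<alpha> \<ge> 0" "M * (4 * (\<alpha> + \<delta>)) \<le> 1 / 2"
    and \<phi>: "\<And>n. odd_periodic T (\<phi> n)" "\<And>n t. \<bar>\<phi> n t\<bar> \<le> \<delta>"
    and \<eta>: "\<And>n. odd_periodic T (\<eta> n)" "\<And>n t. \<bar>\<eta> n t\<bar> \<le> \<delta>"
    and w: "odd_periodic T w" "has_second_derivative w (\<lambda>t. remainder \<alpha> \<phi> n t - potential n t * w t)"
    and v: "odd_periodic T v" "has_second_derivative v (\<lambda>t. remainder \<beta> \<eta> n t - potential n t * v t)"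
    and d: "\<And>m t. \<bar>m - n\<bar> \<le> 1 \<Longrightarrow> \<bar>\<phi> m t - \<eta> m t\<bar> \<le> d"
  shows "\<bar>w t - v t\<bar> \<le> d / 2 + 2 * M * \<bar>\<alpha> - \<beta>\<bar>"
proof -
  have "\<bar>w t - v t\<bar> \<le> M * (4 * (\<alpha> + \<delta>) * d + 2 * \<bar>\<alpha> - \<beta>\<bar>)"
  proof (rule potential_solution_bound[where w = "\<lambda>t. w t - v t"])
    show "odd_periodic T (\<lambda>t. w t - v t)" by (intro odd_periodic_diff w v)
    show "has_second_derivative (\<lambda>t. w t - v t)
        (\<lambda>t. (remainder \<alpha> \<phi> n t - remainder \<beta> \<eta> n t) - potential n t * (w t - v t))"
      using has_second_derivative_diff(1)[OF w(2) v(2)] by (simp add: algebra_simps)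
    show "continuous_on UNIV (\<lambda>t. remainder \<alpha> \<phi> n t - remainder \<beta> \<eta> n t)"
      by (intro continuous_intros odd_periodicD(1)[OF odd_periodic_remainder] \<phi> \<eta>)
    show "\<bar>remainder \<alpha> \<phi> n t - remainder \<beta> \<eta> n t\<bar> \<le> 4 * (\<alpha> + \<delta>) * d + 2 * \<bar>\<alpha> - \<beta>\<bar>" for t
      by (rule remainder_lipschitz[OF \<alpha>(1) \<phi>(2) \<eta>(2) d])
  qed
  also have "\<dots> \<le> d / 2 + 2 * M * \<bar>\<alpha> - \<beta>\<bar>"
    using order_trans[OF abs_ge_zero d[of n 0]] by (intro halving_estimate \<alpha>) simp
  finally show ?thesis .
qed

lemma small_correctionD:
  assumes "small_correction \<alpha> \<delta> \<phi>"
  shows "odd_periodic T (\<phi> n)" "\<bar>\<phi> n t\<bar> \<le> \<delta>"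
    "has_second_derivative (\<phi> n) (\<lambda>t. remainder \<alpha> \<phi> n t - potential n t * \<phi> n t)"
  using assms by (auto simp: small_correction_def)

lemma small_correction_zero:
  assumes "\<delta> \<ge> 0"
  shows "small_correction 0 \<delta> (\<lambda>n t. 0)"
  using assms odd_periodic_zero has_second_derivative_zero
  by (simp add: small_correction_def remainder_def)

text \<open>Solutions reproduce themselves under the linear solve, so \<open>bounded_halving\<close>
  applies to their distance over all sites and times. Equal couplings give uniqueness in the ball;
  comparison with the zero correction at coupling 0 gives its size.\<close>

lemma small_correction_lipschitz:
  assumes \<alpha>: "\<alpha> \<ge> 0" "M * (4 * (\<alpha> + \<delta>)) \<le> 1 / 2"
    and \<phi>: "small_correction \<alpha> \<delta> \<phi>" and \<eta>: "small_correction \<beta> \<delta> \<eta>"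
  shows "\<bar>\<phi> n t - \<eta> n t\<bar> \<le> 4 * M * \<bar>\<alpha> - \<beta>\<bar>"
proof -
  have "(\<lambda>(n, t). \<bar>\<phi> n t - \<eta> n t\<bar>) (n, t) \<le> 2 * (2 * M * \<bar>\<alpha> - \<beta>\<bar>)"
  proof (rule bounded_halving[where K = "2 * \<delta>" and x = "\<lambda>(n, t). \<bar>\<phi> n t - \<eta> n t\<bar>"])
    fix p :: "int \<times> real"
    obtain m s where p: "p = (m, s)" by (cases p)
    show "(\<lambda>(n, t). \<bar>\<phi> n t - \<eta> n t\<bar>) p \<le> 2 * \<delta>"
      using small_correctionD(2)[OF \<phi>, of m s] small_correctionD(2)[OF \<eta>, of m s] p by auto
    fix d assume d: "\<And>p. (\<lambda>(n, t). \<bar>\<phi> n t - \<eta> n t\<bar>) p \<le> d"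
    have "\<bar>\<phi> m s - \<eta> m s\<bar> \<le> d / 2 + 2 * M * \<bar>\<alpha> - \<beta>\<bar>"
      by (rule local_comparison[OF \<alpha> small_correctionD(1,2)[OF \<phi>] small_correctionD(1,2)[OF \<eta>]
          small_correctionD(1,3)[OF \<phi>] small_correctionD(1,3)[OF \<eta>]]) (use d in auto)
    then show "(\<lambda>(n, t). \<bar>\<phi> n t - \<eta> n t\<bar>) p \<le> d / 2 + 2 * M * \<bar>\<alpha> - \<beta>\<bar>"
      by (simp add: p)
  qed
  then show ?thesis by simp
qed

lemma small_correction_exists:
  assumes \<delta>: "\<delta> \<ge> 0" and \<alpha>: "\<alpha> \<ge> 0" "M * (4 * (\<alpha> + \<delta>)) \<le> 1 / 2" "4 * M * \<alpha> \<le> \<delta>"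
  shows "\<exists>\<phi>. small_correction \<alpha> \<delta> \<phi>"
proof -
  define \<Phi> :: "(int \<Rightarrow> real \<Rightarrow> real) \<Rightarrow> int \<Rightarrow> real \<Rightarrow> real" where "\<Phi> = (\<lambda>\<phi> n. SOME w. odd_periodic T w \<and>
    has_second_derivative w (\<lambda>t. remainder \<alpha> \<phi> n t - potential n t * w t))"
  have \<Phi>: "odd_periodic T (\<Phi> \<phi> n)"
    "has_second_derivative (\<Phi> \<phi> n) (\<lambda>t. remainder \<alpha> \<phi> n t - potential n t * \<Phi> \<phi> n t)"
    if "\<And>n. odd_periodic T (\<phi> n)" for \<phi> n
    using someI_ex[OF potential_solution_exists[OF odd_periodic_remainder[OF that]]]
    unfolding \<Phi>_def by auto
  note zero = small_correctionD[OF small_correction_zero[OF \<delta>]]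
  have "\<exists>\<phi>. (\<forall>n. odd_periodic T (\<phi> n)) \<and> (\<forall>n t. \<bar>\<phi> n t\<bar> \<le> \<delta>) \<and> \<Phi> \<phi> = \<phi>"
  proof (rule bounded_family_fixed_point[where \<Phi> = \<Phi>, OF \<delta>])
    fix \<phi> :: "int \<Rightarrow> real \<Rightarrow> real" and n
    assume \<phi>: "\<And>n. odd_periodic T (\<phi> n)" "\<And>n t. \<bar>\<phi> n t\<bar> \<le> \<delta>"
    \<comment> \<open>The ball is mapped to itself by comparison with the zero correction at
      coupling 0: half of \<delta> comes from the contraction, the other half pays for the change of
      coupling.\<close>
    have "\<bar>\<Phi> \<phi> n t - 0\<bar> \<le> \<delta> / 2 + 2 * M * \<bar>\<alpha> - 0\<bar>" for t
      by (rule local_comparison[OF \<alpha>(1,2) \<phi> zero(1,2) \<Phi>[OF \<phi>(1)] zero(1,3)]) (use \<phi> in auto)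
    also have "\<delta> / 2 + 2 * M * \<bar>\<alpha> - 0\<bar> \<le> \<delta>" using \<alpha> by simp
    finally have "\<bar>\<Phi> \<phi> n t\<bar> \<le> \<delta>" for t by simp
    then show "odd_periodic T (\<Phi> \<phi> n) \<and> (\<forall>t. \<bar>\<Phi> \<phi> n t\<bar> \<le> \<delta>)"
      using \<Phi>(1)[of \<phi>] \<phi>(1) by blast
  next
    fix \<phi> \<eta> :: "int \<Rightarrow> real \<Rightarrow> real" and d n t
    assume \<phi>: "\<And>n. odd_periodic T (\<phi> n)" "\<And>n t. \<bar>\<phi> n t\<bar> \<le> \<delta>"
      and \<eta>: "\<And>n. odd_periodic T (\<eta> n)" "\<And>n t. \<bar>\<eta> n t\<bar> \<le> \<delta>"
      and d: "\<And>n t. \<bar>\<phi> n t - \<eta> n t\<bar> \<le> d"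
    have "\<bar>\<Phi> \<phi> n t - \<Phi> \<eta> n t\<bar> \<le> d / 2 + 2 * M * \<bar>\<alpha> - \<alpha>\<bar>"
      by (rule local_comparison[OF \<alpha>(1,2) \<phi> \<eta> \<Phi>[OF \<phi>(1)] \<Phi>[OF \<eta>(1)] d])
    then show "\<bar>\<Phi> \<phi> n t - \<Phi> \<eta> n t\<bar> \<le> d / 2" by simp
  qed
  then obtain \<phi> where \<phi>: "\<And>n. odd_periodic T (\<phi> n)" "\<And>n t. \<bar>\<phi> n t\<bar> \<le> \<delta>" "\<Phi> \<phi> = \<phi>"
    by blast
  then show ?thesis
    using \<Phi>(2)[of \<phi>, OF \<phi>(1)] by (auto simp: small_correction_def)
qed

lemma small_correction_decay:
  assumes \<alpha>: "\<alpha> \<ge> 0" "M * (4 * (\<alpha> + \<delta>)) \<le> 1 / 2" and \<phi>: "small_correction \<alpha> \<delta> \<phi>"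
  shows "\<bar>n\<bar> \<ge> int k + 1 \<Longrightarrow> \<bar>\<phi> n t\<bar> \<le> \<delta> * (1 / 2) ^ k"
proof (induction k arbitrary: n t)
  case 0
  then show ?case using small_correctionD(2)[OF \<phi>] by simp
next
  case (Suc k)
  have \<delta>: "\<delta> \<ge> 0" using order_trans[OF abs_ge_zero small_correctionD(2)[OF \<phi>]] .
  have zero: "has_second_derivative (\<lambda>t. 0) (\<lambda>t. remainder \<alpha> (\<lambda>n t. 0) n t - potential n t * 0)"
  proof -
    \<comment> \<open>Here \<open>\<bar>n\<bar> \<ge> 2\<close>, so the site and both its neighbours
      are at rest; this is why the exponent starts at 0 for sites with
      \<open>\<bar>n\<bar> \<ge> 1\<close>.\<close>
    have "\<Theta> (n - 1) = (\<lambda>t. 0)" "\<Theta> n = (\<lambda>t. 0)" "\<Theta> (n + 1) = (\<lambda>t. 0)"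
      using Suc.prems by (auto simp: one_site_breather_def)
    then show ?thesis
      using has_second_derivative_zero by (simp add: remainder_def tdsg_field_def tdsg_rhs_0)
  qed
  \<comment> \<open>Zero is a local solution at the same coupling \<alpha>, so the coupling term
    disappears and only the halving remains.\<close>
  have "\<bar>\<phi> n t - 0\<bar> \<le> \<delta> * (1 / 2) ^ k / 2 + 2 * M * \<bar>\<alpha> - \<alpha>\<bar>"
  proof (rule local_comparison[OF \<alpha> small_correctionD(1,2)[OF \<phi>] odd_periodic_zero _
        small_correctionD(1,3)[OF \<phi>] odd_periodic_zero zero])
    show "\<bar>\<phi> m t - 0\<bar> \<le> \<delta> * (1 / 2) ^ k" if "\<bar>m - n\<bar> \<le> 1" for m t
      using Suc.IH[of m t] Suc.prems that by simp
  qed (use \<delta> in simp)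
  then show ?case by simp
qed

end

section \<open>Existence, uniqueness and localization of the continued family\<close>

theorem theorem3:
  fixes T :: real and \<theta> :: "real \<Rightarrow> real"
  assumes "T > 2 * pi" and "\<forall>k::nat. T \<noteq> 2 * pi * real k"
    and "pendulum_solution \<theta>" and "odd_fun \<theta>" and "has_minimal_period \<theta> T"
    and "deriv \<theta> 0 > 0"
  shows "\<exists>\<epsilon>>0. \<exists>\<Theta>. breather_family T \<theta> \<epsilon> \<Theta> \<and>
           (\<forall>F. breather_family T \<theta> \<epsilon> F \<longrightarrow> (\<forall>\<alpha>\<in>{0..<\<epsilon>}. F \<alpha> = \<Theta> \<alpha>)) \<and>
           (\<forall>\<alpha>\<in>{0..<\<epsilon>}. \<exists>B>0. \<exists>C>0. \<forall>n.
              sup_norm (\<Theta> \<alpha> n) \<le> C * exp (- B * \<bar>real_of_int n\<bar>))"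
proof -
  interpret nonresonant_breather T \<theta>
    using assms by unfold_locales
  \<comment> \<open>With \<alpha> at most \<delta>, the factor 4 M (\<alpha> + \<delta>) is at most
    8 M \<delta> = 1/2. The second entry of \<epsilon> makes
    \<open>4 * M * \<alpha> \<le> \<delta> / 2\<close>, which puts the corrections into the ball of
    half the radius.\<close>
  define \<delta> where "\<delta> = 1 / (16 * M)"
  define \<epsilon> where "\<epsilon> = min \<delta> (\<delta> / (8 * M))"
  have \<delta>: "\<delta> > 0" and \<epsilon>: "\<epsilon> > 0"
    using M_pos by (simp_all add: \<delta>_def \<epsilon>_def)
  have \<alpha>: "\<alpha> \<ge> 0" "M * (4 * (\<alpha> + \<delta>)) \<le> 1 / 2" "4 * M * \<alpha> \<le> \<delta> / 2" if "\<alpha> \<in> {0..<\<epsilon>}" for \<alpha>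
  proof -
    have "M * (4 * (\<alpha> + \<delta>)) \<le> M * (4 * (\<delta> + \<delta>))"
      using that M_pos by (intro mult_left_mono) (auto simp: \<epsilon>_def)
    also have "\<dots> = 1 / 2" using M_pos by (simp add: \<delta>_def)
    finally show "M * (4 * (\<alpha> + \<delta>)) \<le> 1 / 2" .
    have "\<alpha> \<le> \<delta> / (8 * M)" using that by (simp add: \<epsilon>_def)
    then show "4 * M * \<alpha> \<le> \<delta> / 2" using M_pos by (simp add: field_simps)
  qed (use that in simp)
  define \<phi> where "\<phi> = (\<lambda>\<alpha>. SOME \<phi>. small_correction \<alpha> \<delta> \<phi>)"
  have \<phi>: "small_correction \<alpha> \<delta> (\<phi> \<alpha>)" if "\<alpha> \<in> {0..<\<epsilon>}" for \<alpha>
  proof -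
    have "4 * M * \<alpha> \<le> \<delta>" using \<alpha>(3)[OF that] \<delta> by simp
    then have "\<exists>\<phi>. small_correction \<alpha> \<delta> \<phi>"
      using small_correction_exists[of \<delta> \<alpha>] \<delta> \<alpha>[OF that] by simp
    then show ?thesis unfolding \<phi>_def by (rule someI_ex)
  qed
  note lip = small_correction_lipschitz[OF \<alpha>(1,2)]
  have unique: "\<phi>' = \<phi> \<alpha>" if "\<alpha> \<in> {0..<\<epsilon>}" "small_correction \<alpha> \<delta> \<phi>'" for \<alpha> \<phi>'
    using lip[OF that(1) that(1) that(2) \<phi>[OF that(1)]] by (auto simp: fun_eq_iff)
  have small: "\<bar>\<phi> \<alpha> n t\<bar> \<le> \<delta> / 2" if a: "\<alpha> \<in> {0..<\<epsilon>}" for \<alpha> n t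
    using lip[OF a a \<phi>[OF a] small_correction_zero, of n t] \<alpha>[OF a] \<delta> by simp
  define G where "G = (\<lambda>\<alpha> n t. \<Theta> n t + \<phi> \<alpha> n t)"
  have G: "TDSG_solution \<alpha> (G \<alpha>)" "odd_periodic T (G \<alpha> n)" if "\<alpha> \<in> {0..<\<epsilon>}" for \<alpha> n
    using \<phi>[OF that] odd_periodic_Theta by (auto simp: small_correction_iff G_def odd_periodic_add)
  have Theta_bound: "\<bar>\<Theta> n t\<bar> \<le> pi" for n t
    using abs_theta_less[of t] by (simp add: one_site_breather_def)
  have G_bound: "\<bar>G \<alpha> n t\<bar> \<le> pi + \<delta>" if "\<alpha> \<in> {0..<\<epsilon>}" for \<alpha> n t
    using small_correctionD(2)[OF \<phi>[OF that], of n t] Theta_bound[of n t] unfolding G_def by linarith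
  have G_ode: "has_second_derivative (G \<alpha> n) (tdsg_field \<alpha> (G \<alpha>) n)" if "\<alpha> \<in> {0..<\<epsilon>}" for \<alpha> n
    using G(1)[OF that] by (simp add: TDSG_solution_iff)
  have G_Omega: "G \<alpha> \<in> Omega T" if a: "\<alpha> \<in> {0..<\<epsilon>}" for \<alpha>
  proof -
    have "G \<alpha> n \<in> C2_odd_periodic T" for n
      by (rule C2_odd_periodicI[OF G(2)[OF a] G_ode[OF a]
            odd_periodicD(1)[OF odd_periodic_tdsg_field[OF G(2)[OF a]]]])
    moreover have "C2_norm (G \<alpha> n) \<le> 2 * (pi + \<delta>) + (2 * \<bar>\<alpha>\<bar> + 1)" for n
      by (rule C2_norm_le[OF G_ode[OF a] G_bound[OF a]]) (simp add: tdsg_field_def tdsg_rhs_bounded)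
    ultimately show ?thesis
      by (auto simp: Omega_def intro!: bdd_aboveI2)
  qed
  \<comment> \<open>The form 2 a + b of \<open>C2_norm_le\<close>, where \<open>a\<close> is the
    Lipschitz constant in the sup norm and \<open>b\<close> that of the second derivatives, read off
    from the right-hand side.\<close>
  define K where "K = 2 * (4 * M) + ((4 * \<epsilon> + 2) * (4 * M) + 2)"
  have G_lip: "Omega_norm (\<lambda>n t. G \<beta> n t - G \<alpha> n t) \<in> {0..K * \<bar>\<beta> - \<alpha>\<bar>}"
    if a: "\<alpha> \<in> {0..<\<epsilon>}" and b: "\<beta> \<in> {0..<\<epsilon>}" for \<alpha> \<beta>
  proof -
    have 0: "\<bar>G \<beta> n t - G \<alpha> n t\<bar> \<le> 4 * M * \<bar>\<beta> - \<alpha>\<bar>" for n t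
      using lip[OF b b \<phi>[OF b] \<phi>[OF a], of n t] by (simp add: G_def)
    have 2: "\<bar>tdsg_field \<beta> (G \<beta>) n t - tdsg_field \<alpha> (G \<alpha>) n t\<bar>
        \<le> ((4 * \<epsilon> + 2) * (4 * M) + 2) * \<bar>\<beta> - \<alpha>\<bar>" for n t
    proof -
      have "\<bar>tdsg_field \<beta> (G \<beta>) n t - tdsg_field \<beta> (G \<alpha>) n t\<bar> \<le> (4 * \<beta> + 2) * (4 * M * \<bar>\<beta> - \<alpha>\<bar>)"
        unfolding tdsg_field_def using b by (intro tdsg_rhs_lipschitz 0) auto
      also have "\<dots> \<le> (4 * \<epsilon> + 2) * (4 * M * \<bar>\<beta> - \<alpha>\<bar>)"
        using b M_pos by (intro mult_right_mono) auto
      finally have "\<bar>tdsg_field \<beta> (G \<beta>) n t - tdsg_field \<beta> (G \<alpha>) n t\<bar> \<le> (4 * \<epsilon> + 2) * (4 * M * \<bar>\<beta> - \<alpha>\<bar>)" .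
      moreover have "\<bar>tdsg_field \<beta> (G \<alpha>) n t - tdsg_field \<alpha> (G \<alpha>) n t\<bar> \<le> 2 * \<bar>\<beta> - \<alpha>\<bar>"
        unfolding tdsg_field_def by (rule tdsg_rhs_coupling)
      moreover have "((4 * \<epsilon> + 2) * (4 * M) + 2) * \<bar>\<beta> - \<alpha>\<bar>
          = (4 * \<epsilon> + 2) * (4 * M * \<bar>\<beta> - \<alpha>\<bar>) + 2 * \<bar>\<beta> - \<alpha>\<bar>"
        by (simp add: algebra_simps)
      ultimately show ?thesis by linarith
    qed
    have "C2_norm (\<lambda>t. G \<beta> n t - G \<alpha> n t) \<le> K * \<bar>\<beta> - \<alpha>\<bar>" for n
      using C2_norm_le[OF has_second_derivative_diff(1)[OF G_ode[OF b] G_ode[OF a]] 0 2, of n]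
      by (simp add: K_def algebra_simps)
    then have "Omega_norm (\<lambda>n t. G \<beta> n t - G \<alpha> n t) \<le> K * \<bar>\<beta> - \<alpha>\<bar>"
      unfolding Omega_norm_def by (intro cSUP_least) auto
    moreover have "Omega_norm (\<lambda>n t. G \<beta> n t - G \<alpha> n t) \<ge> 0"
      using Omega_norm_upper[OF T_pos Omega_diff[OF T_pos G_Omega[OF b] G_Omega[OF a]]]
        order_trans[OF abs_ge_zero] by blast
    ultimately show ?thesis by simp
  qed
  have "Omega_continuous_on {0..<\<epsilon>} G"
    unfolding Omega_continuous_on_def
  proof
    fix \<alpha> assume a: "\<alpha> \<in> {0..<\<epsilon>}"
    have "((\<lambda>\<beta>. K * \<bar>\<beta> - \<alpha>\<bar>) \<longlongrightarrow> K * \<bar>\<alpha> - \<alpha>\<bar>) (at \<alpha> within {0..<\<epsilon>})"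
      by (intro tendsto_intros)
    then have lim: "((\<lambda>\<beta>. K * \<bar>\<beta> - \<alpha>\<bar>) \<longlongrightarrow> 0) (at \<alpha> within {0..<\<epsilon>})" by simp
    show "((\<lambda>\<beta>. Omega_norm (\<lambda>n t. G \<beta> n t - G \<alpha> n t)) \<longlongrightarrow> 0) (at \<alpha> within {0..<\<epsilon>})"
      by (rule tendsto_sandwich[OF _ _ tendsto_const lim])
         (use G_lip[OF a] in \<open>auto simp: eventually_at_filter\<close>)
  qed
  moreover have "G 0 = \<Theta>"
  proof -
    have "0 \<in> {0..<\<epsilon>}" using \<epsilon> by simp
    from unique[OF this small_correction_zero] \<delta> show ?thesis
      by (simp add: G_def fun_eq_iff)
  qed
  ultimately have "breather_family T \<theta> \<epsilon> G"
    using G_Omega G(1) by (auto simp: breather_family_def)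
  moreover have "F \<alpha> = G \<alpha>" if F: "breather_family T \<theta> \<epsilon> F" and a: "\<alpha> \<in> {0..<\<epsilon>}" for F \<alpha>
  proof -
    have F_Omega: "F \<beta> \<in> Omega T" and F_sol: "TDSG_solution \<beta> (F \<beta>)" if "\<beta> \<in> {0..<\<epsilon>}" for \<beta>
      using F that by (auto simp: breather_family_def)
    have F_eq: "F \<beta> = G \<beta>" if b: "\<beta> \<in> {0..<\<epsilon>}" and le: "\<And>n t. \<bar>F \<beta> n t - \<Theta> n t\<bar> \<le> \<delta>" for \<beta>
    proof -
      have "small_correction \<beta> \<delta> (\<lambda>n t. F \<beta> n t - \<Theta> n t)"
        using le F_sol[OF b] C2_odd_periodicD(1)[OF OmegaD(1)[OF F_Omega[OF b]]]
        by (simp add: small_correction_iff odd_periodic_diff odd_periodic_Theta)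
      then have "(\<lambda>n t. F \<beta> n t - \<Theta> n t) = \<phi> \<beta>" by (rule unique[OF b])
      then show ?thesis by (simp add: G_def fun_eq_iff) (metis add.commute diff_add_cancel)
    qed
    define P where "P = (\<lambda>\<beta>. \<forall>n t. \<bar>F \<beta> n t - \<Theta> n t\<bar> \<le> \<delta> / 2)"
    have "P \<alpha>"
    proof (rule connected_induction_simple[of "{0..<\<epsilon>}" 0 \<alpha>])
      show "P 0" using F \<delta> by (simp add: P_def breather_family_def)
      fix \<beta> assume b: "\<beta> \<in> {0..<\<epsilon>}"
      have "((\<lambda>\<gamma>. Omega_norm (\<lambda>n t. F \<gamma> n t - F \<beta> n t)) \<longlongrightarrow> 0) (at \<beta> within {0..<\<epsilon>})"
        using F b by (auto simp: breather_family_def Omega_continuous_on_def)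
      then have "\<forall>\<^sub>F \<gamma> in at \<beta> within {0..<\<epsilon>}. Omega_norm (\<lambda>n t. F \<gamma> n t - F \<beta> n t) < \<delta> / 4"
        by (rule order_tendstoD) (use \<delta> in simp)
      then obtain r where r: "r > 0"
        "\<And>\<gamma>. \<gamma> \<in> {0..<\<epsilon>} \<Longrightarrow> \<gamma> \<noteq> \<beta> \<Longrightarrow> dist \<gamma> \<beta> < r \<Longrightarrow> Omega_norm (\<lambda>n t. F \<gamma> n t - F \<beta> n t) < \<delta> / 4"
        unfolding eventually_at by blast
      have near: "\<bar>F \<gamma> n t - F \<beta> n t\<bar> \<le> \<delta> / 4" if "\<gamma> \<in> {0..<\<epsilon>} \<inter> ball \<beta> r" for \<gamma> n t
      proof (cases "\<gamma> = \<beta>")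
        case False
        have "\<bar>F \<gamma> n t - F \<beta> n t\<bar> \<le> Omega_norm (\<lambda>n t. F \<gamma> n t - F \<beta> n t)"
          using that by (intro Omega_norm_upper[OF T_pos Omega_diff[OF T_pos]] F_Omega b) auto
        also have "\<dots> < \<delta> / 4" using r(2)[of \<gamma>] False that by (auto simp: dist_commute)
        finally show ?thesis by simp
      qed (use \<delta> in simp)
      \<comment> \<open>Passing from \<open>x\<close> to \<open>y\<close> through \<beta> costs two
        quarters of \<delta>, so half of \<delta> grows to at most \<delta>. In that ball the
        solution is unique, hence equal to \<open>G y\<close>, and \<open>small\<close> restores the
        half.\<close>
      have step: "P y" if x: "x \<in> {0..<\<epsilon>} \<inter> ball \<beta> r" and y: "y \<in> {0..<\<epsilon>} \<inter> ball \<beta> r" and "P x" for x y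
      proof -
        have "\<bar>F y n t - \<Theta> n t\<bar> \<le> \<delta>" for n t
          using near[OF x, of n t] near[OF y, of n t] \<open>P x\<close>[unfolded P_def, rule_format, of n t] by linarith
        then have "F y = G y" using y by (intro F_eq) auto
        then show "P y" using small[of y] y by (simp add: P_def G_def)
      qed
      show "\<exists>U. openin (top_of_set {0..<\<epsilon>}) U \<and> \<beta> \<in> U \<and> (\<forall>x\<in>U. \<forall>y\<in>U. P x \<longrightarrow> P y)"
      proof (intro exI conjI ballI impI)
        show "openin (top_of_set {0..<\<epsilon>}) ({0..<\<epsilon>} \<inter> ball \<beta> r)"
          by (rule openin_open_Int[OF open_ball])
        show "\<beta> \<in> {0..<\<epsilon>} \<inter> ball \<beta> r" using b r(1) by simp
      qed (rule step)
    qed (use a \<epsilon> in auto)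
    then have "\<bar>F \<alpha> n t - \<Theta> n t\<bar> \<le> \<delta> / 2" for n t by (simp add: P_def)
    then have "\<bar>F \<alpha> n t - \<Theta> n t\<bar> \<le> \<delta>" for n t
      by (rule order_trans) (use \<delta> in simp)
    then show ?thesis by (rule F_eq[OF a])
  qed
  moreover have "\<exists>B>0. \<exists>C>0. \<forall>n. sup_norm (G \<alpha> n) \<le> C * exp (- B * \<bar>real_of_int n\<bar>)"
    if a: "\<alpha> \<in> {0..<\<epsilon>}" for \<alpha>
  proof (intro exI conjI allI)
    fix n
    \<comment> \<open>The witnesses, fixed by the final \<open>show\<close>, are B = ln 2 and C = pi
      + 2 \<delta>: the halving per site is an exponential with rate ln 2.\<close>
    have exp_eq: "exp (- ln 2 * \<bar>real_of_int n\<bar>) = (1 / 2) ^ nat \<bar>n\<bar>"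
    proof -
      have "\<bar>real_of_int n\<bar> = real (nat \<bar>n\<bar>)" by simp
      then have "exp (- ln 2 * \<bar>real_of_int n\<bar>) = exp (- ln 2 :: real) ^ nat \<bar>n\<bar>"
        by (metis exp_of_nat2_mult)
      then show ?thesis by (simp add: exp_minus divide_simps)
    qed
    have "\<bar>G \<alpha> n t\<bar> \<le> (pi + 2 * \<delta>) * (1 / 2) ^ nat \<bar>n\<bar>" for t
    proof (cases "n = 0")
      case True
      then show ?thesis using G_bound[OF a, of 0 t] \<delta> by simp
    next
      case False
      \<comment> \<open>The decay exponent lags the site number by one, which costs the factor 2 in
        front of \<delta>; the pi in the constant is for the central site.\<close>
      define k where "k = nat \<bar>n\<bar> - 1"
      have k: "nat \<bar>n\<bar> = Suc k" "\<bar>n\<bar> \<ge> int k + 1" using False by (auto simp: k_def)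
      have "\<bar>G \<alpha> n t\<bar> = \<bar>\<phi> \<alpha> n t\<bar>" using False by (simp add: G_def one_site_breather_def)
      also have "\<dots> \<le> 2 * \<delta> * (1 / 2) ^ nat \<bar>n\<bar>"
        using small_correction_decay[OF \<alpha>(1,2)[OF a] \<phi>[OF a] k(2), of t] by (simp add: k(1))
      also have "\<dots> \<le> (pi + 2 * \<delta>) * (1 / 2) ^ nat \<bar>n\<bar>"
        by (intro mult_right_mono) auto
      finally show ?thesis .
    qed
    then show "sup_norm (G \<alpha> n) \<le> (pi + 2 * \<delta>) * exp (- ln 2 * \<bar>real_of_int n\<bar>)"
      unfolding sup_norm_def exp_eq by (intro cSUP_least) auto
    show "0 < pi + 2 * \<delta>" using \<delta> pi_gt_zero by linarith
  qed simp
  ultimately show ?thesis using \<epsilon> by blast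
qed

end
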